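(* In every (degenerate or non-degenerate) geometric algebra $C\ell_{p,q,r}$, $p+q+r=n\ge 1$, the groups $A^{\overline{01}}_{p,q,r}$, $A^{\overline{23}}_{p,q,r}$, $B^{\overline{12}}_{p,q,r}$, $B^{\overline{03}}_{p,q,r}$ and the groups $\Gamma^{\overline{kl}}_{p,q,r}$ (all defined in the context) satisfy $$A^{\overline{01}}_{p,q,r}=\psi^{-1}(Z^{1\times}_{p,q,r})=\Gamma^{\overline{01}}_{p,q,r}\ \subseteq\ A^{\overline{23}}_{p,q,r}=\psi^{-1}\big((Z^{2}_{p,q,r}\cap Z^{3}_{p,q,r})^{\times}\big)=\Gamma^{\overline{23}}_{p,q,r},$$ $$B^{\overline{12}}_{p,q,r}=\chi^{-1}(Z^{1\times}_{p,q,r})=\Gamma^{\overline{12}}_{p,q,r}\ \subseteq\ B^{\overline{03}}_{p,q,r}=\chi^{-1}(Z^{3\times}_{p,q,r})=\Gamma^{\overline{03}}_{p,q,r}.$$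
   Context: $C\ell_{p,q,r}$, $p+q+r=n\ge1$, is the Clifford (geometric) algebra over the real space $\mathbb{R}^{p,q,r}$ or the complex space $\mathbb{C}^{p+q,0,r}$ (field $\mathbb{F}=\mathbb{R}$ or $\mathbb{C}$ respectively), with identity $e$ and generators $e_1,\dots,e_n$ satisfying $e_ae_b+e_be_a=2\eta_{ab}e$, where $\eta$ is diagonal with $p$ entries $+1$, then $q$ entries $-1$, then $r$ entries $0$ (in the complex case, $p+q$ entries $+1$ and $r$ entries $0$). $C\ell^k_{p,q,r}$ is the grade-$k$ subspace, spanned by $e_{a_1}\cdots e_{a_k}$, $a_1<\dots<a_k$ (it is $\{0\}$ for $k<0$ or $k>n$). $\widehat U$ is the grade involution (multiplication by $(-1)^k$ on grade $k$), $\widetilde U$ is the reversion (multiplication by $(-1)^{k(k-1)/2}$ on grade $k$, an anti-automorphism), $\widehat{\widetilde U}$ is the Clifford conjugation. For $k=0,1,2,3$, $C\ell^{\overline{k}}_{p,q,r}=\{U:\ \widehat U=(-1)^kU,\ \widetilde U=(-1)^{k(k-1)/2}U\}$ (the direct sum of the subspaces of grades congruent to $k$ mod $4$), and $C\ell^{\overline{kl}}_{p,q,r}=C\ell^{\overline{k}}_{p,q,r}\oplus C\ell^{\overline{l}}_{p,q,r}$. For a subset $H\subseteq C\ell_{p,q,r}$, $H^\times$ denotes the set of invertible elements of $H$. Centralizers of grade subspaces: $Z^m_{p,q,r}=\{X\in C\ell_{p,q,r}:\ XV=VX\ \ \forall V\in C\ell^m_{p,q,r}\}$ (if $m>n$,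 then $C\ell^m_{p,q,r}=\{0\}$ and $Z^m_{p,q,r}=C\ell_{p,q,r}$). $Z^1_{p,q,r}$ is the center of $C\ell_{p,q,r}$. Norm functions: $\psi(T)=\widetilde T T$, $\chi(T)=\widehat{\widetilde T}T$. Groups: $A^{\overline{01}}_{p,q,r}=\{T\in C\ell^\times_{p,q,r}:\ \widetilde TT\in Z^{1\times}_{p,q,r}\}$, $A^{\overline{23}}_{p,q,r}=\{T\in C\ell^\times_{p,q,r}:\ \widetilde TT\in (Z^{2}_{p,q,r}\cap Z^{3}_{p,q,r})^\times\}$, $B^{\overline{12}}_{p,q,r}=\{T\in C\ell^\times_{p,q,r}:\ \widehat{\widetilde T}T\in Z^{1\times}_{p,q,r}\}$, $B^{\overline{03}}_{p,q,r}=\{T\in C\ell^\times_{p,q,r}:\ \widehat{\widetilde T}T\in Z^{3\times}_{p,q,r}\}$, and $\Gamma^{\overline{kl}}_{p,q,r}=\{T\in C\ell^\times_{p,q,r}:\ T\,C\ell^{\overline{kl}}_{p,q,r}\,T^{-1}\subseteq C\ell^{\overline{kl}}_{p,q,r}\}$. *)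

theory Defs
  imports Complex_Main "HOL-Algebra.Module" "HOL-Algebra.AbelCoset"
begin

section \<open>The Clifford algebra of a diagonal form\<close>

text \<open>
  A diagonal metric on an n-dimensional space is given by the list \<open>\<eta>\<close> of its n diagonal
  entries.  Generators are numbered from 0, so the generators \<open>e_1, ..., e_n\<close> of the
  literature are \<open>gen \<eta> 0, ..., gen \<eta> (n - 1)\<close>.

  A multivector is represented by its coordinates with respect to the basis of the ordered
  products of distinct generators: \<open>U A\<close> is the coefficient of the product of the generators
  with index in \<open>A\<close>, in increasing order.  That the coordinate vectors really are these products,
  and that the generators satisfy the Clifford relations, is proved below (\<open>blade_eq\<close>,
  \<open>gen_anticommutator\<close>).
\<close>

text \<open>
  \<open>e_A e_B\<close> is a multiple of \<open>e_C\<close>, where \<open>C\<close> is the symmetric difference of \<open>A\<close> and \<open>B\<close>: sorting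
  costs one sign for each pair of distinct indices in the wrong order, and each common index \<open>i\<close>
  contributes the square of its generator.
\<close>

definition blade_coeff :: "'f::field list \<Rightarrow> nat set \<Rightarrow> nat set \<Rightarrow> 'f" where
  "blade_coeff \<eta> A B =
     (-1) ^ card {(i, j). i \<in> A \<and> j \<in> B \<and> j < i} * (\<Prod>i\<in>A \<inter> B. \<eta> ! i)"

definition clifford :: "'f::field list \<Rightarrow> ('f, nat set \<Rightarrow> 'f) module" where
  "clifford \<eta> =
    \<lparr> carrier = {U. \<forall>A. \<not> A \<subseteq> {..<length \<eta>} \<longrightarrow> U A = 0},
      mult = (\<lambda>U V A. \<Sum>B\<in>Pow {..<length \<eta>}.
                 blade_coeff \<eta> B (sym_diff B A) * U B * V (sym_diff B A)),
      one = (\<lambda>A. if A = {} then 1 else 0),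
      zero = (\<lambda>A. 0),
      add = (\<lambda>U V A. U A + V A),
      smult = (\<lambda>c U A. c * U A) \<rparr>"

definition gen :: "'f::field list \<Rightarrow> nat \<Rightarrow> nat set \<Rightarrow> 'f" where
  "gen \<eta> a = (\<lambda>A. if A = {a} then 1 else 0)"

definition blade :: "'f::field list \<Rightarrow> nat set \<Rightarrow> nat set \<Rightarrow> 'f" where
  "blade \<eta> A =
     foldr (mult (clifford \<eta>)) (map (gen \<eta>) (sorted_list_of_set A)) \<one>\<^bsub>clifford \<eta>\<^esub>"

definition real_metric :: "nat \<Rightarrow> nat \<Rightarrow> nat \<Rightarrow> real list" where
  "real_metric p q r = replicate p 1 @ replicate q (-1) @ replicate r 0"

definition complex_metric :: "nat \<Rightarrow> nat \<Rightarrow> nat \<Rightarrow> complex list" where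
  "complex_metric p q r = replicate (p + q) 1 @ replicate r 0"


section \<open>Grades, involutions and the groups\<close>

definition grade_subspace :: "'f::field list \<Rightarrow> nat \<Rightarrow> (nat set \<Rightarrow> 'f) set" where
  "grade_subspace \<eta> k =
     {\<Oplus>\<^bsub>clifford \<eta>\<^esub>A\<in>{A. A \<subseteq> {..<length \<eta>} \<and> card A = k}. c A \<odot>\<^bsub>clifford \<eta>\<^esub> blade \<eta> A | c. True}"

definition grade_involution :: "(nat set \<Rightarrow> 'f::field) \<Rightarrow> nat set \<Rightarrow> 'f" where
  "grade_involution U = (\<lambda>A. (-1) ^ card A * U A)"

definition reversion :: "(nat set \<Rightarrow> 'f::field) \<Rightarrow> nat set \<Rightarrow> 'f" where
  "reversion U = (\<lambda>A. (-1) ^ (card A * (card A - 1) div 2) * U A)"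

definition Cl_bar :: "'f::field list \<Rightarrow> nat \<Rightarrow> (nat set \<Rightarrow> 'f) set" where
  "Cl_bar \<eta> k =
     {U \<in> carrier (clifford \<eta>).
        grade_involution U = (-1) ^ k \<odot>\<^bsub>clifford \<eta>\<^esub> U \<and>
        reversion U = (-1) ^ (k * (k - 1) div 2) \<odot>\<^bsub>clifford \<eta>\<^esub> U}"

definition Cl_bar2 :: "'f::field list \<Rightarrow> nat \<Rightarrow> nat \<Rightarrow> (nat set \<Rightarrow> 'f) set" where
  "Cl_bar2 \<eta> k l = Cl_bar \<eta> k <+>\<^bsub>clifford \<eta>\<^esub> Cl_bar \<eta> l"

definition invertibles :: "'f::field list \<Rightarrow> (nat set \<Rightarrow> 'f) set \<Rightarrow> (nat set \<Rightarrow> 'f) set" where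
  "invertibles \<eta> H = H \<inter> Units (clifford \<eta>)"

definition Z :: "'f::field list \<Rightarrow> nat \<Rightarrow> (nat set \<Rightarrow> 'f) set" where
  "Z \<eta> m =
     {X \<in> carrier (clifford \<eta>). \<forall>V\<in>grade_subspace \<eta> m.
        X \<otimes>\<^bsub>clifford \<eta>\<^esub> V = V \<otimes>\<^bsub>clifford \<eta>\<^esub> X}"

definition psi :: "'f::field list \<Rightarrow> (nat set \<Rightarrow> 'f) \<Rightarrow> nat set \<Rightarrow> 'f" where
  "psi \<eta> T = reversion T \<otimes>\<^bsub>clifford \<eta>\<^esub> T"

definition chi :: "'f::field list \<Rightarrow> (nat set \<Rightarrow> 'f) \<Rightarrow> nat set \<Rightarrow> 'f" where
  "chi \<eta> T = grade_involution (reversion T) \<otimes>\<^bsub>clifford \<eta>\<^esub> T"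

text \<open>
  The norm functions are defined on the whole algebra, so the preimages below are taken in the
  algebra and not only in its group of units.
\<close>

definition psi_preimage :: "'f::field list \<Rightarrow> (nat set \<Rightarrow> 'f) set \<Rightarrow> (nat set \<Rightarrow> 'f) set" where
  "psi_preimage \<eta> H = psi \<eta> -` H \<inter> carrier (clifford \<eta>)"

definition chi_preimage :: "'f::field list \<Rightarrow> (nat set \<Rightarrow> 'f) set \<Rightarrow> (nat set \<Rightarrow> 'f) set" where
  "chi_preimage \<eta> H = chi \<eta> -` H \<inter> carrier (clifford \<eta>)"

definition A01 :: "'f::field list \<Rightarrow> (nat set \<Rightarrow> 'f) set" where
  "A01 \<eta> = {T \<in> Units (clifford \<eta>).
     reversion T \<otimes>\<^bsub>clifford \<eta>\<^esub> T \<in> invertibles \<eta> (Z \<eta> 1)}"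

definition A23 :: "'f::field list \<Rightarrow> (nat set \<Rightarrow> 'f) set" where
  "A23 \<eta> = {T \<in> Units (clifford \<eta>).
     reversion T \<otimes>\<^bsub>clifford \<eta>\<^esub> T \<in> invertibles \<eta> (Z \<eta> 2 \<inter> Z \<eta> 3)}"

definition B12 :: "'f::field list \<Rightarrow> (nat set \<Rightarrow> 'f) set" where
  "B12 \<eta> = {T \<in> Units (clifford \<eta>).
     grade_involution (reversion T) \<otimes>\<^bsub>clifford \<eta>\<^esub> T \<in> invertibles \<eta> (Z \<eta> 1)}"

definition B03 :: "'f::field list \<Rightarrow> (nat set \<Rightarrow> 'f) set" where
  "B03 \<eta> = {T \<in> Units (clifford \<eta>).
     grade_involution (reversion T) \<otimes>\<^bsub>clifford \<eta>\<^esub> T \<in> invertibles \<eta> (Z \<eta> 3)}"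

definition Gam :: "'f::field list \<Rightarrow> nat \<Rightarrow> nat \<Rightarrow> (nat set \<Rightarrow> 'f) set" where
  "Gam \<eta> k l =
     {T \<in> Units (clifford \<eta>). \<forall>U\<in>Cl_bar2 \<eta> k l.
        T \<otimes>\<^bsub>clifford \<eta>\<^esub> U \<otimes>\<^bsub>clifford \<eta>\<^esub> inv\<^bsub>clifford \<eta>\<^esub> T \<in> Cl_bar2 \<eta> k l}"


section \<open>The construction is the Clifford algebra\<close>

lemma prod_sym_diff_sign:
  fixes f :: "nat \<Rightarrow> 'f::field"
  assumes "finite A" "finite B" "\<And>i. f i * f i = 1"
  shows "prod f (sym_diff A B) = prod f A * prod f B"
proof -
  have 1: "prod f A = prod f (A - B) * prod f (A \<inter> B)"
    using assms by (subst prod.union_disjoint [symmetric]) (auto intro: prod.cong)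
  have 2: "prod f B = prod f (B - A) * prod f (A \<inter> B)"
    using assms by (subst prod.union_disjoint [symmetric]) (auto intro: prod.cong)
  have 3: "prod f (A \<inter> B) * prod f (A \<inter> B) = 1"
    by (simp add: prod.distrib [symmetric] assms)
  have 4: "prod f (sym_diff A B) = prod f (A - B) * prod f (B - A)"
    using assms by (intro prod.union_disjoint) auto
  have "prod f A * prod f B = prod f (A - B) * prod f (B - A) * (prod f (A \<inter> B) * prod f (A \<inter> B))"
    unfolding 1 2 by (simp add: ac_simps)
  then show ?thesis using 3 4 by simp
qed

definition swap_sign :: "nat set \<Rightarrow> nat set \<Rightarrow> 'f::field" where
  "swap_sign A B = (\<Prod>i\<in>A. \<Prod>j\<in>B. if j < i then -1 else 1)"

lemma swap_sign_eq:
  assumes "finite A" "finite B"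
  shows "(-1) ^ card {(i, j). i \<in> A \<and> j \<in> B \<and> j < i} = (swap_sign A B :: 'f::field)"
proof -
  have "swap_sign A B = (\<Prod>(i,j)\<in>A \<times> B. if j < i then -1 else (1::'f))"
    by (simp add: swap_sign_def prod.cartesian_product)
  also have "\<dots> = (\<Prod>x\<in>{(i, j). i \<in> A \<and> j \<in> B \<and> j < i}. -1)"
    using assms by (intro prod.mono_neutral_cong_right) (auto split: if_splits)
  finally show ?thesis by simp
qed

lemma swap_sign_left:
  assumes "finite A" "finite B" "finite C"
  shows "swap_sign (sym_diff A B) C = swap_sign A C * (swap_sign B C :: 'f::field)"
  unfolding swap_sign_def using assms
  by (intro prod_sym_diff_sign) (auto simp: prod.distrib [symmetric] intro!: prod.neutral)

lemma swap_sign_right: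
  assumes "finite A" "finite B" "finite C"
  shows "swap_sign A (sym_diff B C) = swap_sign A B * (swap_sign A C :: 'f::field)"
proof -
  have "(\<Prod>j\<in>sym_diff B C. if j < i then -1 else (1::'f)) =
     (\<Prod>j\<in>B. if j < i then -1 else 1) * (\<Prod>j\<in>C. if j < i then -1 else 1)" for i
    using assms by (intro prod_sym_diff_sign) auto
  then show ?thesis by (simp add: swap_sign_def prod.distrib)
qed

lemma blade_coeff_cocycle:
  assumes "finite A" "finite B" "finite C"
  shows "blade_coeff \<eta> (sym_diff A B) C * blade_coeff \<eta> A B =
         blade_coeff \<eta> A (sym_diff B C) * blade_coeff \<eta> B C"
proof -
  let ?p = "\<lambda>S. \<Prod>i\<in>S. \<eta> ! i"
  have "?p (sym_diff A B \<inter> C) * ?p (A \<inter> B) = ?p ((sym_diff A B \<inter> C) \<union> (A \<inter> B))"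
    using assms by (intro prod.union_disjoint [symmetric]) auto
  also have "(sym_diff A B \<inter> C) \<union> (A \<inter> B) = (A \<inter> sym_diff B C) \<union> (B \<inter> C)" by blast
  also have "?p \<dots> = ?p (A \<inter> sym_diff B C) * ?p (B \<inter> C)"
    using assms by (intro prod.union_disjoint) auto
  finally have p: "?p (sym_diff A B \<inter> C) * ?p (A \<inter> B) = ?p (A \<inter> sym_diff B C) * ?p (B \<inter> C)" .
  have f: "finite (sym_diff A B)" "finite (sym_diff B C)" using assms by auto
  have "blade_coeff \<eta> (sym_diff A B) C * blade_coeff \<eta> A B =
     (swap_sign A C * swap_sign B C * swap_sign A B) * (?p (sym_diff A B \<inter> C) * ?p (A \<inter> B))"
    unfolding blade_coeff_def swap_sign_eq[OF f(1) assms(3)] swap_sign_eq[OF assms(1,2)]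
      swap_sign_left[OF assms] by (simp only: ac_simps)
  also have "\<dots> = (swap_sign A B * swap_sign A C * swap_sign B C) *
      (?p (A \<inter> sym_diff B C) * ?p (B \<inter> C))"
    unfolding p by (simp only: ac_simps)
  also have "\<dots> = blade_coeff \<eta> A (sym_diff B C) * blade_coeff \<eta> B C"
    unfolding blade_coeff_def swap_sign_eq[OF assms(1) f(2)] swap_sign_eq[OF assms(2,3)]
      swap_sign_right[OF assms] by (simp only: ac_simps)
  finally show ?thesis .
qed

lemma clifford_simps:
  "carrier (clifford \<eta>) = {U. \<forall>A. \<not> A \<subseteq> {..<length \<eta>} \<longrightarrow> U A = 0}"
  "\<one>\<^bsub>clifford \<eta>\<^esub> = (\<lambda>A. if A = {} then 1 else 0)"
  "\<zero>\<^bsub>clifford \<eta>\<^esub> = (\<lambda>A. 0)"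
  "U \<oplus>\<^bsub>clifford \<eta>\<^esub> V = (\<lambda>A. U A + V A)"
  "c \<odot>\<^bsub>clifford \<eta>\<^esub> U = (\<lambda>A. c * U A)"
  by (simp_all add: clifford_def)

lemma clifford_mult:
  "(U \<otimes>\<^bsub>clifford \<eta>\<^esub> V) A =
     (\<Sum>B\<in>Pow {..<length \<eta>}. blade_coeff \<eta> B (sym_diff B A) * U B * V (sym_diff B A))"
  by (simp add: clifford_def)

lemma clifford_mult_closed:
  assumes "V \<in> carrier (clifford \<eta>)"
  shows "U \<otimes>\<^bsub>clifford \<eta>\<^esub> V \<in> carrier (clifford \<eta>)"
proof -
  have "V (sym_diff B A) = 0" if "B \<subseteq> {..<length \<eta>}" "\<not> A \<subseteq> {..<length \<eta>}" for A B
  proof -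
    have "\<not> sym_diff B A \<subseteq> {..<length \<eta>}" using that by blast
    then show ?thesis using assms by (simp add: clifford_simps(1))
  qed
  then have "(U \<otimes>\<^bsub>clifford \<eta>\<^esub> V) A = 0" if "\<not> A \<subseteq> {..<length \<eta>}" for A
    unfolding clifford_mult using that by (intro sum.neutral) auto
  then show ?thesis by (simp add: clifford_simps(1))
qed

lemma clifford_assoc:
  assumes "W \<in> carrier (clifford \<eta>)"
  shows
  "(U \<otimes>\<^bsub>clifford \<eta>\<^esub> V) \<otimes>\<^bsub>clifford \<eta>\<^esub> W = U \<otimes>\<^bsub>clifford \<eta>\<^esub> (V \<otimes>\<^bsub>clifford \<eta>\<^esub> W)"
proof
  fix A
  let ?P = "Pow {..<length \<eta>}"
  let ?k = "blade_coeff \<eta>"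
  have fin: "finite B" if "B \<in> ?P" for B
    using that by (auto intro: finite_subset)
  show "((U \<otimes>\<^bsub>clifford \<eta>\<^esub> V) \<otimes>\<^bsub>clifford \<eta>\<^esub> W) A = (U \<otimes>\<^bsub>clifford \<eta>\<^esub> (V \<otimes>\<^bsub>clifford \<eta>\<^esub> W)) A"
  proof (cases "finite A")
    case False
    then have "\<not> A \<subseteq> {..<length \<eta>}" using finite_subset by blast
    then show ?thesis
      using clifford_mult_closed[OF assms, of "U \<otimes>\<^bsub>clifford \<eta>\<^esub> V"]
        clifford_mult_closed[OF clifford_mult_closed[OF assms], of U V]
      by (simp add: clifford_simps(1))
  next
    case True
    have "((U \<otimes>\<^bsub>clifford \<eta>\<^esub> V) \<otimes>\<^bsub>clifford \<eta>\<^esub> W) A =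
        (\<Sum>C\<in>?P. \<Sum>B\<in>?P. ?k C (sym_diff C A) * ?k B (sym_diff B C) *
            U B * V (sym_diff B C) * W (sym_diff C A))"
      by (simp add: clifford_mult sum_distrib_left sum_distrib_right ac_simps)
    also have "\<dots> = (\<Sum>B\<in>?P. \<Sum>C\<in>?P. ?k C (sym_diff C A) * ?k B (sym_diff B C) *
            U B * V (sym_diff B C) * W (sym_diff C A))"
      by (rule sum.swap)
    also have "\<dots> = (\<Sum>B\<in>?P. \<Sum>D\<in>?P. ?k B (sym_diff B A) * ?k D (sym_diff D (sym_diff B A)) *
            U B * V D * W (sym_diff D (sym_diff B A)))"
    proof (rule sum.cong[OF refl])
      fix B assume B: "B \<in> ?P"
      show "(\<Sum>C\<in>?P. ?k C (sym_diff C A) * ?k B (sym_diff B C) *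
            U B * V (sym_diff B C) * W (sym_diff C A)) =
          (\<Sum>D\<in>?P. ?k B (sym_diff B A) * ?k D (sym_diff D (sym_diff B A)) *
            U B * V D * W (sym_diff D (sym_diff B A)))"
      proof (rule sum.reindex_bij_witness[of _ "\<lambda>D. sym_diff B D" "\<lambda>C. sym_diff B C"])
        fix C assume C: "C \<in> ?P"
        let ?D = "sym_diff B C"
        have e1: "sym_diff B ?D = C" by blast
        have e2: "sym_diff ?D (sym_diff B A) = sym_diff C A" by blast
        have e3: "sym_diff ?D (sym_diff C A) = sym_diff B A" by blast
        show "sym_diff B ?D = C" by (rule e1)
        show "?D \<in> ?P" using B C by blast
        have f: "finite ?D" "finite (sym_diff C A)" using fin[OF B] fin[OF C] True by auto
        have "?k C (sym_diff C A) * ?k B ?D = ?k B (sym_diff B A) * ?k ?D (sym_diff C A)"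
          using blade_coeff_cocycle[OF fin[OF B] f, of \<eta>] unfolding e1 e3 .
        then show "?k B (sym_diff B A) * ?k ?D (sym_diff ?D (sym_diff B A)) *
             U B * V ?D * W (sym_diff ?D (sym_diff B A)) =
           ?k C (sym_diff C A) * ?k B ?D * U B * V ?D * W (sym_diff C A)"
          unfolding e2 by simp
      next
        fix D assume D: "D \<in> ?P"
        show "sym_diff B (sym_diff B D) = D" by blast
        show "sym_diff B D \<in> ?P" using B D by blast
      qed
    qed
    also have "\<dots> = (U \<otimes>\<^bsub>clifford \<eta>\<^esub> (V \<otimes>\<^bsub>clifford \<eta>\<^esub> W)) A"
      by (simp add: clifford_mult sum_distrib_left sum_distrib_right ac_simps)
    finally show ?thesis .
  qed
qed

lemma clifford_one_l: "\<one>\<^bsub>clifford \<eta>\<^esub> \<otimes>\<^bsub>clifford \<eta>\<^esub> U = U"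
proof
  fix A
  have "(\<one>\<^bsub>clifford \<eta>\<^esub> \<otimes>\<^bsub>clifford \<eta>\<^esub> U) A =
      (\<Sum>B\<in>Pow {..<length \<eta>}. if B = {} then U A else 0)"
    unfolding clifford_mult clifford_simps by (intro sum.cong) (auto simp: blade_coeff_def)
  then show "(\<one>\<^bsub>clifford \<eta>\<^esub> \<otimes>\<^bsub>clifford \<eta>\<^esub> U) A = U A" by simp
qed

lemma clifford_one_r:
  assumes "U \<in> carrier (clifford \<eta>)"
  shows "U \<otimes>\<^bsub>clifford \<eta>\<^esub> \<one>\<^bsub>clifford \<eta>\<^esub> = U"
proof
  fix A
  have "(U \<otimes>\<^bsub>clifford \<eta>\<^esub> \<one>\<^bsub>clifford \<eta>\<^esub>) A =
      (\<Sum>B\<in>Pow {..<length \<eta>}. if B = A then U A else 0)"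
    unfolding clifford_mult clifford_simps by (intro sum.cong) (auto simp: blade_coeff_def)
  then show "(U \<otimes>\<^bsub>clifford \<eta>\<^esub> \<one>\<^bsub>clifford \<eta>\<^esub>) A = U A"
    using assms by (simp add: clifford_simps)
qed

lemma ring_clifford: "ring (clifford \<eta>)"
proof (rule ringI)
  show "abelian_group (clifford \<eta>)"
  proof (rule abelian_groupI)
    fix U assume "U \<in> carrier (clifford \<eta>)"
    then show "\<exists>V\<in>carrier (clifford \<eta>). V \<oplus>\<^bsub>clifford \<eta>\<^esub> U = \<zero>\<^bsub>clifford \<eta>\<^esub>"
      by (intro bexI[of _ "\<lambda>A. - U A"]) (auto simp: clifford_simps)
  qed (auto simp: clifford_simps add.assoc add.commute)
  show "monoid (clifford \<eta>)"
    by (rule monoidI)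
      (auto simp: clifford_mult_closed clifford_assoc clifford_one_l clifford_one_r,
        auto simp: clifford_simps)
qed (auto simp: fun_eq_iff clifford_mult clifford_simps(4) sum.distrib algebra_simps)

text \<open>The locale \<open>algebra\<close> of HOL-Algebra is for commutative algebras only.\<close>

definition scalars :: "'f::field ring" where
  "scalars = \<lparr>carrier = UNIV, mult = (*), one = 1, zero = 0, add = (+)\<rparr>"

lemma cring_scalars: "cring (scalars :: 'f::field ring)"
proof (rule cringI)
  show "abelian_group (scalars :: 'f ring)"
    by (rule abelian_groupI) (auto simp: scalars_def add.assoc add.commute intro: exI[of _ "- _"])
  show "comm_monoid (scalars :: 'f ring)"
    by (rule comm_monoidI) (auto simp: scalars_def mult.assoc mult.commute)
qed (auto simp: scalars_def algebra_simps)

lemma module_clifford: "module scalars (clifford \<eta>)"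
  using cring_scalars ring.is_abelian_group[OF ring_clifford]
  by (rule moduleI) (auto simp: scalars_def clifford_simps algebra_simps)

lemma clifford_smult_mult:
  "(c \<odot>\<^bsub>clifford \<eta>\<^esub> U) \<otimes>\<^bsub>clifford \<eta>\<^esub> V = c \<odot>\<^bsub>clifford \<eta>\<^esub> (U \<otimes>\<^bsub>clifford \<eta>\<^esub> V)"
  "U \<otimes>\<^bsub>clifford \<eta>\<^esub> (c \<odot>\<^bsub>clifford \<eta>\<^esub> V) = c \<odot>\<^bsub>clifford \<eta>\<^esub> (U \<otimes>\<^bsub>clifford \<eta>\<^esub> V)"
  by (auto simp: fun_eq_iff clifford_mult clifford_simps(5) sum_distrib_left ac_simps)

lemma gen_mult:
  assumes "a < length \<eta>"
  shows "(gen \<eta> a \<otimes>\<^bsub>clifford \<eta>\<^esub> U) A =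
    blade_coeff \<eta> {a} (sym_diff {a} A) * U (sym_diff {a} A)"
proof -
  have "(gen \<eta> a \<otimes>\<^bsub>clifford \<eta>\<^esub> U) A = (\<Sum>B\<in>Pow {..<length \<eta>}.
      if B = {a} then blade_coeff \<eta> {a} (sym_diff {a} A) * U (sym_diff {a} A) else 0)"
    unfolding clifford_mult gen_def by (intro sum.cong) auto
  then show ?thesis using assms by simp
qed

lemma gen_mult_unit:
  assumes "a < length \<eta>"
  shows "gen \<eta> a \<otimes>\<^bsub>clifford \<eta>\<^esub> (\<lambda>B. if B = C then 1 else 0) =
    (\<lambda>B. if B = sym_diff {a} C then blade_coeff \<eta> {a} C else 0)"
proof
  fix A
  have "sym_diff {a} A = C \<longleftrightarrow> A = sym_diff {a} C" by blast
  then show "(gen \<eta> a \<otimes>\<^bsub>clifford \<eta>\<^esub> (\<lambda>B. if B = C then 1 else 0)) A =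
      (if A = sym_diff {a} C then blade_coeff \<eta> {a} C else 0)"
    unfolding gen_mult[OF assms] by auto
qed

lemma gen_closed: "a < length \<eta> \<Longrightarrow> gen \<eta> a \<in> carrier (clifford \<eta>)"
  by (auto simp: gen_def clifford_simps)

lemma blade_coeff_single:
  "blade_coeff \<eta> {a} {b} = (if a = b then \<eta> ! a else if b < a then -1 else 1)"
proof -
  have "{(i, j). i \<in> {a} \<and> j \<in> {b} \<and> j < i} = (if b < a then {(a, b)} else {})" by auto
  then show ?thesis by (auto simp: blade_coeff_def)
qed

lemma gen_anticommutator:
  assumes "a < length \<eta>" "b < length \<eta>"
  shows "gen \<eta> a \<otimes>\<^bsub>clifford \<eta>\<^esub> gen \<eta> b \<oplus>\<^bsub>clifford \<eta>\<^esub> gen \<eta> b \<otimes>\<^bsub>clifford \<eta>\<^esub> gen \<eta> a =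
    (2 * (if a = b then \<eta> ! a else 0)) \<odot>\<^bsub>clifford \<eta>\<^esub> \<one>\<^bsub>clifford \<eta>\<^esub>"
proof -
  have "sym_diff {b} {a} = sym_diff {a} {b}" by blast
  then show ?thesis
    unfolding gen_def[of \<eta> a] gen_def[of \<eta> b]
      gen_mult_unit[OF assms(1), unfolded gen_def] gen_mult_unit[OF assms(2), unfolded gen_def]
    by (auto simp: fun_eq_iff clifford_simps blade_coeff_single)
qed

lemma blade_eq:
  assumes "A \<subseteq> {..<length \<eta>}"
  shows "blade \<eta> A = (\<lambda>B. if B = A then 1 else 0)"
proof -
  have *: "foldr (mult (clifford \<eta>)) (map (gen \<eta>) xs) \<one>\<^bsub>clifford \<eta>\<^esub> =
      (\<lambda>B. if B = set xs then 1 else 0)"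
    if "sorted_wrt (<) xs" "set xs \<subseteq> {..<length \<eta>}" for xs
    using that
  proof (induction xs)
    case Nil
    then show ?case by (simp add: clifford_simps)
  next
    case (Cons a xs)
    have e: "{(i, j). i \<in> {a} \<and> j \<in> set xs \<and> j < i} = {}" and a: "a \<notin> set xs"
      using Cons.prems by auto
    have c: "blade_coeff \<eta> {a} (set xs) = 1" unfolding blade_coeff_def e using a by simp
    have d: "sym_diff {a} (set xs) = set (a # xs)" using a by auto
    show ?case using Cons gen_mult_unit[of a \<eta> "set xs", unfolded c d] by simp
  qed
  have "finite A" using assms by (auto intro: finite_subset)
  then show ?thesis using assms *[of "sorted_list_of_set A"] by (simp add: blade_def)
qed

lemma clifford_finsum:
  assumes "finite S" "\<And>s. s \<in> S \<Longrightarrow> f s \<in> carrier (clifford \<eta>)"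
  shows "(\<Oplus>\<^bsub>clifford \<eta>\<^esub>s\<in>S. f s) = (\<lambda>A. \<Sum>s\<in>S. f s A)"
proof -
  interpret ring "clifford \<eta>" by (rule ring_clifford)
  show ?thesis using assms
  proof (induction S rule: finite_induct)
    case empty
    then show ?case by (simp add: clifford_simps)
  next
    case (insert s S)
    then have "(\<Oplus>\<^bsub>clifford \<eta>\<^esub>s\<in>insert s S. f s) = f s \<oplus>\<^bsub>clifford \<eta>\<^esub> (\<Oplus>\<^bsub>clifford \<eta>\<^esub>s\<in>S. f s)"
      by (intro finsum_insert) auto
    then show ?case using insert by (simp add: clifford_simps)
  qed
qed

lemma blade_combination:
  assumes "S \<subseteq> Pow {..<length \<eta>}"
  shows "(\<Oplus>\<^bsub>clifford \<eta>\<^esub>A\<in>S. c A \<odot>\<^bsub>clifford \<eta>\<^esub> blade \<eta> A) = (\<lambda>A. if A \<in> S then c A else 0)"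
proof -
  have S: "finite S" using assms by (rule finite_subset) simp
  have 1: "c A \<odot>\<^bsub>clifford \<eta>\<^esub> blade \<eta> A = (\<lambda>B. if A = B then c A else 0)" if "A \<in> S" for A
  proof -
    have "A \<subseteq> {..<length \<eta>}" using that assms by blast
    then show ?thesis by (auto simp: blade_eq clifford_simps fun_eq_iff)
  qed
  have "(\<Oplus>\<^bsub>clifford \<eta>\<^esub>A\<in>S. c A \<odot>\<^bsub>clifford \<eta>\<^esub> blade \<eta> A) =
      (\<lambda>B. \<Sum>A\<in>S. (c A \<odot>\<^bsub>clifford \<eta>\<^esub> blade \<eta> A) B)"
    using assms by (intro clifford_finsum S) (auto simp: 1 clifford_simps(1))
  also have "\<dots> = (\<lambda>B. \<Sum>A\<in>S. if A = B then c A else 0)"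
    by (intro ext sum.cong) (simp_all add: 1)
  finally show ?thesis using S by simp
qed

lemma blade_expansion:
  assumes "U \<in> carrier (clifford \<eta>)"
  shows "U = (\<Oplus>\<^bsub>clifford \<eta>\<^esub>A\<in>Pow {..<length \<eta>}. U A \<odot>\<^bsub>clifford \<eta>\<^esub> blade \<eta> A)"
  using assms by (auto simp: blade_combination clifford_simps(1) fun_eq_iff)

lemma grade_subspace_eq:
  "grade_subspace \<eta> k = {U \<in> carrier (clifford \<eta>). \<forall>A. U A \<noteq> 0 \<longrightarrow> card A = k}"
proof -
  let ?S = "{A. A \<subseteq> {..<length \<eta>} \<and> card A = k}"
  have "grade_subspace \<eta> k = {\<lambda>A. if A \<in> ?S then c A else 0 | c. True}"
    unfolding grade_subspace_def by (subst blade_combination) auto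
  also have "\<dots> = {U. \<forall>A. A \<notin> ?S \<longrightarrow> U A = 0}" (is "?L = ?R")
  proof
    show "?L \<subseteq> ?R"
    proof
      fix U assume "U \<in> ?L"
      then obtain c where "U = (\<lambda>A. if A \<in> ?S then c A else 0)" by blast
      then have "U A = 0" if "A \<notin> ?S" for A using that by (simp only: if_False)
      then show "U \<in> ?R" by blast
    qed
    show "?R \<subseteq> ?L"
    proof
      fix U assume "U \<in> ?R"
      then have "U = (\<lambda>A. if A \<in> ?S then U A else 0)" by (auto simp: fun_eq_iff)
      then show "U \<in> ?L" by blast
    qed
  qed
  also have "\<dots> = {U \<in> carrier (clifford \<eta>). \<forall>A. U A \<noteq> 0 \<longrightarrow> card A = k}"
    unfolding clifford_simps(1) by blast
  finally show ?thesis .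
qed

end

theory Submission
  imports Defs "HOL-Library.Function_Algebras"
begin

text \<open>
  The real and the complex case are instances of one theorem about an arbitrary diagonal form over a
  field of characteristic 0 (\<open>norm_groups_eq_stabilizers\<close>).

  Let \<open>\<sigma>\<close> be reversion or Clifford conjugation.  Both are anti-automorphisms that multiply each
  grade by a sign of period 4 in the grade, so the four subspaces in question are exactly their
  eigenspaces: the grades \<open>0, 1\<close> and \<open>2, 3\<close> modulo 4 are the eigenspaces of reversion for the
  eigenvalues \<open>1\<close> and \<open>- 1\<close>, and the grades \<open>0, 3\<close> and \<open>1, 2\<close> are those of the conjugation.
  If \<open>\<sigma> U = c U\<close> with \<open>c = \<plusminus>1\<close>, then \<open>\<sigma> (T U T\<^sup>-\<^sup>1) = c \<sigma>(T)\<^sup>-\<^sup>1 U \<sigma>(T)\<close>, and this is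
  \<open>c T U T\<^sup>-\<^sup>1\<close> if and only if \<open>\<sigma>(T) T\<close> commutes with \<open>U\<close>
  (\<open>conjugate_in_eigenspace_iff\<close>).  Hence each group \<open>\<Gamma>\<close> consists of the units whose norm lies in the
  centralizer of the corresponding subspace, and what remains is to compute four centralizers.

  Centralizers of sums of grades are spanned by basis blades, since any two basis blades commute
  or anticommute and multiplication by a blade permutes the blades up to scalars, which may be zero
  (\<open>commutes_with_grades_iff\<close>).  So the question is one about index sets.  The decisive fact is
  \<open>centralizer_odd_grade\<close>: for odd \<open>m\<close>, what commutes with grade \<open>m\<close> commutes with all higher
  grades.
  It gives the centralizers (\<open>Z 1\<close> for the grades \<open>0, 1\<close> and \<open>1, 2\<close>; \<open>Z 2 \<inter> Z 3\<close> for the grades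
  \<open>2, 3\<close>; \<open>Z 3\<close> for the grades \<open>0, 3\<close>) as well as the two inclusions.
  It also covers the degenerate case, in which higher grades need not be generated by products of
  lower ones: with a zero form, for instance, the product of two blades of grade 3 is never a nonzero
  multiple of a blade of grade 4.

  The preimages under the norm functions are taken in the whole algebra.  They consist of units
  because in a finite-dimensional algebra an element with a left inverse is a unit.
\<close>

section \<open>Left-invertible elements are units\<close>

text \<open>
  If \<open>S T = 1\<close>, then \<open>X \<mapsto> T X\<close> is an injective linear map of the algebra to itself.  If
  \<open>1\<close> were not in its image, the image of a basis together with \<open>1\<close> would be an independent set
  with more elements than the basis.  So \<open>T\<close> also has a right inverse.
\<close>

lemma left_invertible_imp_unit:
  fixes \<eta> :: "'f::field list"
  assumes S: "S \<in> carrier (clifford \<eta>)" and T: "T \<in> carrier (clifford \<eta>)"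
    and ST: "S \<otimes>\<^bsub>clifford \<eta>\<^esub> T = \<one>\<^bsub>clifford \<eta>\<^esub>"
  shows "T \<in> Units (clifford \<eta>)"
proof -
  interpret R: ring "clifford \<eta>" by (rule ring_clifford)
  define scale where "scale = (\<lambda>(c::'f) (U::nat set \<Rightarrow> 'f) A. c * U A)"
  define L where "L = (\<lambda>X. T \<otimes>\<^bsub>clifford \<eta>\<^esub> X)"
  interpret vs: vector_space scale
    by unfold_locales (auto simp: scale_def fun_eq_iff algebra_simps)
  interpret L: Vector_Spaces.linear scale scale L
    by unfold_locales
      (auto simp: scale_def L_def fun_eq_iff clifford_mult algebra_simps sum.distrib sum_distrib_left)
  let ?V = "carrier (clifford \<eta>)"
  let ?E = "(\<lambda>A B. if B = A then 1 else (0::'f)) ` Pow {..<length \<eta>}"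
  have subspace: "vs.subspace ?V"
    unfolding vs.subspace_def by (auto simp: clifford_simps scale_def)
  have V_E: "?V \<subseteq> vs.span ?E"
  proof
    fix U assume U: "U \<in> ?V"
    have sum_apply: "(\<Sum>A\<in>K. f A) B = (\<Sum>A\<in>K. f A B)"
      for f :: "nat set \<Rightarrow> nat set \<Rightarrow> 'f" and K B
      by (induction K rule: infinite_finite_induct) auto
    have "U = (\<Sum>A\<in>Pow {..<length \<eta>}. scale (U A) (\<lambda>B. if B = A then 1 else 0))"
    proof
      fix B
      have "(\<Sum>A\<in>Pow {..<length \<eta>}. scale (U A) (\<lambda>B. if B = A then 1 else 0)) B =
          (\<Sum>A\<in>Pow {..<length \<eta>}. if B = A then U A else 0)"
        unfolding sum_apply by (intro sum.cong) (auto simp: scale_def)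
      also have "\<dots> = U B" using U by (auto simp: clifford_simps)
      finally show "U B = (\<Sum>A\<in>Pow {..<length \<eta>}. scale (U A) (\<lambda>B. if B = A then 1 else 0)) B" ..
    qed
    also have "\<dots> \<in> vs.span ?E"
      by (intro vs.span_sum vs.span_scale vs.span_base imageI)
    finally show "U \<in> vs.span ?E" .
  qed
  obtain B where B: "B \<subseteq> ?V" "vs.independent B" "?V \<subseteq> vs.span B"
    by (rule vs.basis_exists[of ?V])
  have span_B: "vs.span B \<subseteq> ?V" using B(1) subspace by (rule vs.span_minimal)
  have fin_B: "finite B"
    using vs.independent_span_bound[OF _ B(2) subset_trans[OF B(1) V_E]] by simp
  have inj: "inj_on L (vs.span B)"
  proof (rule inj_onI)
    fix X Y assume "X \<in> vs.span B" "Y \<in> vs.span B" and LXY: "L X = L Y"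
    then have XY: "X \<in> ?V" "Y \<in> ?V" using span_B by auto
    have "S \<otimes>\<^bsub>clifford \<eta>\<^esub> L X = S \<otimes>\<^bsub>clifford \<eta>\<^esub> L Y" by (simp only: LXY)
    then show "X = Y" using S T XY ST by (simp add: L_def R.m_assoc[symmetric])
  qed
  have indep: "vs.independent (L ` B)"
    by (rule contrapos_nn[OF B(2) L.dependent_inj_imageD[OF _ inj]])
  have "\<one>\<^bsub>clifford \<eta>\<^esub> \<in> vs.span (L ` B)"
  proof (rule ccontr)
    assume not_in: "\<one>\<^bsub>clifford \<eta>\<^esub> \<notin> vs.span (L ` B)"
    have sub: "insert \<one>\<^bsub>clifford \<eta>\<^esub> (L ` B) \<subseteq> vs.span B"
      using B(1,3) T by (auto simp: L_def)
    have "card (insert \<one>\<^bsub>clifford \<eta>\<^esub> (L ` B)) \<le> card B"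
      using vs.independent_span_bound[OF fin_B vs.independent_insertI[OF not_in indep] sub] ..
    moreover have "\<one>\<^bsub>clifford \<eta>\<^esub> \<notin> L ` B" using not_in by (auto intro: vs.span_base)
    moreover have "card (L ` B) = card B"
      by (intro card_image inj_on_subset[OF inj] vs.span_superset)
    ultimately show False using fin_B by simp
  qed
  then have "\<one>\<^bsub>clifford \<eta>\<^esub> \<in> L ` vs.span B" by (simp only: L.span_image)
  then obtain X where "X \<in> vs.span B" "\<one>\<^bsub>clifford \<eta>\<^esub> = L X" by (elim imageE) auto
  then have X: "X \<in> ?V" "T \<otimes>\<^bsub>clifford \<eta>\<^esub> X = \<one>\<^bsub>clifford \<eta>\<^esub>"
    using span_B by (auto simp only: L_def)
  have "S = S \<otimes>\<^bsub>clifford \<eta>\<^esub> (T \<otimes>\<^bsub>clifford \<eta>\<^esub> X)" using S X(2) by simp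
  also have "\<dots> = X" using S T X(1) ST by (simp add: R.m_assoc[symmetric])
  finally show ?thesis using S T ST X(2) by (auto simp: Units_def)
qed

lemma left_factor_of_unit_imp_unit:
  assumes "S \<in> carrier (clifford \<eta>)" "T \<in> carrier (clifford \<eta>)"
    and "S \<otimes>\<^bsub>clifford \<eta>\<^esub> T \<in> Units (clifford \<eta>)"
  shows "T \<in> Units (clifford \<eta>)"
proof -
  interpret R: ring "clifford \<eta>" by (rule ring_clifford)
  let ?N = "S \<otimes>\<^bsub>clifford \<eta>\<^esub> T"
  have "(inv\<^bsub>clifford \<eta>\<^esub> ?N \<otimes>\<^bsub>clifford \<eta>\<^esub> S) \<otimes>\<^bsub>clifford \<eta>\<^esub> T = \<one>\<^bsub>clifford \<eta>\<^esub>"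
    using assms by (simp add: R.m_assoc)
  then show ?thesis using assms by (intro left_invertible_imp_unit) auto
qed


section \<open>Commutation of blades\<close>

text \<open>
  Of the \<open>|A| |B|\<close> pairs, the \<open>|A \<inter> B|\<close> diagonal ones cost no swap in either order, and
  each other one costs a swap in exactly one of the two orders.
\<close>

lemma blade_coeff_swap:
  assumes "finite A" "finite B"
  shows "blade_coeff \<eta> B A = (-1) ^ (card A * card B + card (A \<inter> B)) * blade_coeff \<eta> A B"
proof -
  let ?lt = "{(i, j). i \<in> A \<and> j \<in> B \<and> j < i}"
  let ?gt = "{(i, j). i \<in> A \<and> j \<in> B \<and> i < j}"
  let ?eq = "(\<lambda>i. (i, i)) ` (A \<inter> B)"
  have fin: "finite ?lt" "finite ?gt" "finite ?eq"
    using assms by (auto intro: finite_subset[of _ "A \<times> B"])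
  have "A \<times> B = ?lt \<union> ?gt \<union> ?eq" by force
  then have "card (A \<times> B) = card (?lt \<union> ?gt \<union> ?eq)" by (simp only:)
  also have "\<dots> = card ?lt + card ?gt + card ?eq"
    using fin by (subst card_Un_disjoint; (subst card_Un_disjoint)?; auto)
  finally have total: "card A * card B = card ?lt + card ?gt + card (A \<inter> B)"
    by (simp add: card_image inj_on_def card_cartesian_product)
  have "{(i, j). i \<in> B \<and> j \<in> A \<and> j < i} = prod.swap ` ?gt" by force
  then have "card {(i, j). i \<in> B \<and> j \<in> A \<and> j < i} = card ?gt"
    by (simp add: card_image)
  then show ?thesis
    unfolding blade_coeff_def total
    by (simp add: power_add Int_commute flip: power_mult_distrib mult.assoc)
qed

text \<open>
  Grade subspaces and the subspaces of given grades modulo 4 are both of this kind, so one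
  description of centralizers serves for both.
\<close>

definition grades :: "'f::field list \<Rightarrow> nat set \<Rightarrow> (nat set \<Rightarrow> 'f) set" where
  "grades \<eta> K = {U \<in> carrier (clifford \<eta>). \<forall>A. U A \<noteq> 0 \<longrightarrow> card A \<in> K}"

definition centralizer :: "'f::field list \<Rightarrow> (nat set \<Rightarrow> 'f) set \<Rightarrow> (nat set \<Rightarrow> 'f) set" where
  "centralizer \<eta> H = {X \<in> carrier (clifford \<eta>). \<forall>V\<in>H.
     X \<otimes>\<^bsub>clifford \<eta>\<^esub> V = V \<otimes>\<^bsub>clifford \<eta>\<^esub> X}"

lemma Z_eq_centralizer: "Z \<eta> m = centralizer \<eta> (grades \<eta> {m})"
  by (simp add: Z_def centralizer_def grades_def grade_subspace_eq)

lemma centralizer_mono: "H \<subseteq> H' \<Longrightarrow> centralizer \<eta> H' \<subseteq> centralizer \<eta> H"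
  by (auto simp: centralizer_def)

lemma grades_mono: "K \<subseteq> L \<Longrightarrow> grades \<eta> K \<subseteq> grades \<eta> L"
  by (auto simp: grades_def)

text \<open>
  The two products of \<open>X\<close> with a blade \<open>e\<^sub>B\<close> can be compared coefficient by coefficient, because
  distinct blades \<open>e\<^sub>A\<close> in \<open>X\<close> contribute to distinct blades of the product.
\<close>

lemma commutes_with_grades_iff:
  assumes X: "X \<in> carrier (clifford \<eta>)"
  shows "X \<in> centralizer \<eta> (grades \<eta> K) \<longleftrightarrow>
    (\<forall>A B. X A \<noteq> 0 \<longrightarrow> B \<subseteq> {..<length \<eta>} \<longrightarrow> card B \<in> K \<longrightarrow>
      blade_coeff \<eta> A B = blade_coeff \<eta> B A)" (is "?L \<longleftrightarrow> ?R")
proof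
  assume ?L
  show ?R
  proof (intro allI impI)
    fix A B assume A: "X A \<noteq> 0" and B: "B \<subseteq> {..<length \<eta>}" "card B \<in> K"
    have A': "A \<subseteq> {..<length \<eta>}" using X A by (auto simp: clifford_simps)
    let ?e = "\<lambda>C. if C = B then 1 else (0::'a)"
    have "?e \<in> grades \<eta> K" using B by (auto simp: grades_def clifford_simps)
    then have comm: "X \<otimes>\<^bsub>clifford \<eta>\<^esub> ?e = ?e \<otimes>\<^bsub>clifford \<eta>\<^esub> X"
      using \<open>?L\<close> unfolding centralizer_def by blast
    have [simp]: "sym_diff A (sym_diff A B) = B" "sym_diff B (sym_diff A B) = A" by auto
    have sd: "sym_diff C (sym_diff A B) = B \<longleftrightarrow> C = A" for C by blast
    have "(X \<otimes>\<^bsub>clifford \<eta>\<^esub> ?e) (sym_diff A B) =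
        (\<Sum>C\<in>Pow {..<length \<eta>}. if C = A then blade_coeff \<eta> A B * X A else 0)"
      unfolding clifford_mult sd by (intro sum.cong) auto
    also have "\<dots> = blade_coeff \<eta> A B * X A" using A' by simp
    finally have 1: "(X \<otimes>\<^bsub>clifford \<eta>\<^esub> ?e) (sym_diff A B) = blade_coeff \<eta> A B * X A" .
    have "(?e \<otimes>\<^bsub>clifford \<eta>\<^esub> X) (sym_diff A B) =
        (\<Sum>C\<in>Pow {..<length \<eta>}. if C = B then blade_coeff \<eta> B A * X A else 0)"
      unfolding clifford_mult by (intro sum.cong) auto
    also have "\<dots> = blade_coeff \<eta> B A * X A" using B by simp
    finally show "blade_coeff \<eta> A B = blade_coeff \<eta> B A" using 1 A comm by simp
  qed
next
  assume R: ?R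
  have "X \<otimes>\<^bsub>clifford \<eta>\<^esub> V = V \<otimes>\<^bsub>clifford \<eta>\<^esub> X" if V: "V \<in> grades \<eta> K" for V
  proof
    fix A
    have support: "D \<subseteq> {..<length \<eta>}" "card D \<in> K" if "V D \<noteq> 0" for D
      using V that unfolding grades_def clifford_simps(1) by blast+
    have closed: "X \<otimes>\<^bsub>clifford \<eta>\<^esub> V \<in> carrier (clifford \<eta>)" "V \<otimes>\<^bsub>clifford \<eta>\<^esub> X \<in> carrier (clifford \<eta>)"
      using X V by (auto simp: grades_def intro: clifford_mult_closed)
    show "(X \<otimes>\<^bsub>clifford \<eta>\<^esub> V) A = (V \<otimes>\<^bsub>clifford \<eta>\<^esub> X) A"
    proof (cases "A \<subseteq> {..<length \<eta>}")
      case False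
      then show ?thesis using closed by (simp add: clifford_simps)
    next
      case True
      have "blade_coeff \<eta> C (sym_diff C A) * X C * V (sym_diff C A) =
          blade_coeff \<eta> (sym_diff C A) C * V (sym_diff C A) * X C" for C
      proof (cases "X C = 0 \<or> V (sym_diff C A) = 0")
        case False
        then have "V (sym_diff C A) \<noteq> 0" by simp
        note support[OF this]
        moreover have "X C \<noteq> 0" using False by simp
        ultimately have "blade_coeff \<eta> C (sym_diff C A) = blade_coeff \<eta> (sym_diff C A) C"
          using R by blast
        then show ?thesis by (simp only: mult_ac)
      qed auto
      then have "(X \<otimes>\<^bsub>clifford \<eta>\<^esub> V) A = (\<Sum>C\<in>Pow {..<length \<eta>}.
          blade_coeff \<eta> (sym_diff C A) C * V (sym_diff C A) * X C)"
        unfolding clifford_mult by (intro sum.cong refl)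
      also have "\<dots> = (V \<otimes>\<^bsub>clifford \<eta>\<^esub> X) A"
        unfolding clifford_mult
      proof (rule sum.reindex_bij_witness[of _ "\<lambda>C. sym_diff C A" "\<lambda>C. sym_diff C A"])
        fix C
        have [simp]: "sym_diff (sym_diff C A) A = C" by blast
        show "sym_diff (sym_diff C A) A = C" "sym_diff (sym_diff C A) A = C" by simp_all
        show "blade_coeff \<eta> (sym_diff C A) (sym_diff (sym_diff C A) A) * V (sym_diff C A) *
            X (sym_diff (sym_diff C A) A) = blade_coeff \<eta> (sym_diff C A) C * V (sym_diff C A) * X C"
          by simp
      qed (use True in blast)+
      finally show ?thesis .
    qed
  qed
  then show ?L using X by (simp add: centralizer_def)
qed

lemma blade_coeff_commute_iff:
  fixes \<eta> :: "'f::field_char_0 list"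
  assumes "finite A" "finite B"
  shows "blade_coeff \<eta> A B = blade_coeff \<eta> B A \<longleftrightarrow>
    (\<exists>i\<in>A \<inter> B. \<eta> ! i = 0) \<or> (even (card A * card B) \<longleftrightarrow> even (card (A \<inter> B)))"
proof -
  have "blade_coeff \<eta> A B = 0 \<longleftrightarrow> (\<exists>i\<in>A \<inter> B. \<eta> ! i = 0)"
    using assms by (simp add: blade_coeff_def)
  then show ?thesis
    unfolding blade_coeff_swap[OF assms]
    by (auto simp: minus_one_power_iff)
qed

text \<open>
  Let \<open>e\<^sub>A\<close> commute with all blades of grade \<open>m\<close>, and let \<open>B\<close> have more than \<open>m\<close> elements and no null
  generator in common with \<open>A\<close>.  Then \<open>|A \<inter> C|\<close> has the parity of \<open>m |A|\<close> for all
  \<open>m\<close>-subsets \<open>C\<close> of \<open>B\<close>.  Exchanging one element of \<open>C\<close> for another one of \<open>B\<close> does not change this parity,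
  so \<open>A\<close> contains all of \<open>B\<close> or nothing of it.  As \<open>m\<close> is odd, \<open>|A|\<close> is odd in the first case and even
  in the second, and \<open>e\<^sub>A\<close> commutes with \<open>e\<^sub>B\<close> in both.
\<close>

lemma blade_commutes_above_odd_grade:
  fixes \<eta> :: "'f::field_char_0 list"
  assumes m: "odd m" and fin: "finite A" "finite B" and B: "m \<le> card B"
    and comm: "\<And>C. C \<subseteq> B \<Longrightarrow> card C = m \<Longrightarrow> blade_coeff \<eta> A C = blade_coeff \<eta> C A"
  shows "blade_coeff \<eta> A B = blade_coeff \<eta> B A"
proof (cases "(\<exists>i\<in>A \<inter> B. \<eta> ! i = 0) \<or> card B = m")
  case True
  then show ?thesis using comm[of B] by (auto simp: blade_coeff_commute_iff fin)
next
  case False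
  have parity: "even (card A) \<longleftrightarrow> even (card (A \<inter> C))" if "C \<subseteq> B" "card C = m" for C
    using comm[OF that] False m that finite_subset[OF that(1) fin(2)] fin
    by (auto simp: blade_coeff_commute_iff)
  have all_or_none: "x \<in> A \<longleftrightarrow> y \<in> A" if xy: "x \<in> B" "y \<in> B" "x \<noteq> y" for x y
  proof -
    \<comment> \<open>Two \<open>m\<close>-subsets of \<open>B\<close> that differ only in \<open>x\<close> and \<open>y\<close>; their common part \<open>D\<close> exists as
      \<open>m < |B|\<close>.\<close>
    have "m < card B" using B False by auto
    then have "m - 1 \<le> card (B - {x, y})"
      using xy fin by (simp add: card_Diff_subset)
    then obtain D where D: "D \<subseteq> B - {x, y}" "card D = m - 1" "finite D"
      using obtain_subset_with_card_n by metis
    have "x \<notin> D" "y \<notin> D" using D(1) by auto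
    have card: "card (insert z D) = m" if "z \<in> {x, y}" for z
      using that D m by (auto simp: card_insert_if elim: oddE)
    have "even (card (A \<inter> insert x D)) \<longleftrightarrow> even (card (A \<inter> insert y D))"
      using parity[of "insert x D"] parity[of "insert y D"] card D(1) xy by auto
    then show ?thesis using \<open>x \<notin> D\<close> \<open>y \<notin> D\<close> D(3) by (auto simp: Int_insert_right split: if_splits)
  qed
  obtain C where C: "C \<subseteq> B" "card C = m" using B obtain_subset_with_card_n by metis
  obtain x where "x \<in> C" using C(2) m by fastforce
  have "B \<subseteq> A \<or> A \<inter> B = {}" using all_or_none by blast
  then show ?thesis
  proof
    assume "B \<subseteq> A"
    then have "A \<inter> C = C" "A \<inter> B = B" using C(1) by auto
    then show ?thesis using parity[OF C] C(2) m by (simp add: blade_coeff_commute_iff fin)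
  next
    assume AB: "A \<inter> B = {}"
    then have "A \<inter> C = {}" using C(1) by auto
    then show ?thesis using parity[OF C] AB by (simp add: blade_coeff_commute_iff fin)
  qed
qed

lemma centralizer_odd_grade:
  fixes \<eta> :: "'f::field_char_0 list"
  assumes m: "odd m" and K: "\<And>k. k \<in> K \<Longrightarrow> k = 0 \<or> m \<le> k"
  shows "Z \<eta> m \<subseteq> centralizer \<eta> (grades \<eta> K)"
proof
  fix X assume X: "X \<in> Z \<eta> m"
  then have carrier: "X \<in> carrier (clifford \<eta>)" by (simp add: Z_def)
  note comm = X[unfolded Z_eq_centralizer commutes_with_grades_iff[OF carrier]]
  have "blade_coeff \<eta> A B = blade_coeff \<eta> B A"
    if A: "X A \<noteq> 0" and B: "B \<subseteq> {..<length \<eta>}" "card B \<in> K" for A B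
  proof -
    have "A \<subseteq> {..<length \<eta>}" using A carrier by (auto simp: clifford_simps)
    then have fin: "finite A" "finite B" using B(1) by (auto intro: finite_subset)
    show ?thesis
    proof (cases "card B = 0")
      case True
      then show ?thesis using fin by (simp add: blade_coeff_def)
    next
      case False
      then show ?thesis
        using K[OF B(2)] comm A B(1) by (intro blade_commutes_above_odd_grade[OF m fin]) auto
    qed
  qed
  then show "X \<in> centralizer \<eta> (grades \<eta> K)" unfolding commutes_with_grades_iff[OF carrier] by blast
qed


section \<open>Reversion and Clifford conjugation\<close>

text \<open>
  With \<open>x = |A - B|\<close>, \<open>y = |B - A|\<close>, \<open>z = |A \<inter> B|\<close>, this compares the reversion signs of \<open>e\<^sub>A e\<^sub>B\<close>,
  \<open>e\<^sub>A\<close> and \<open>e\<^sub>B\<close>; the last term is the sign of swapping \<open>e\<^sub>A\<close> and \<open>e\<^sub>B\<close>.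
\<close>

lemma reversion_sign_parity:
  fixes x y z :: nat
  shows "even ((x + y) * (x + y - 1) div 2) \<longleftrightarrow>
    even ((x + z) * (x + z - 1) div 2 + (y + z) * (y + z - 1) div 2 + ((x + z) * (y + z) + z))"
proof -
  have sum: "(a + b) * (a + b - 1) div 2 = a * (a - 1) div 2 + b * (b - 1) div 2 + a * b"
    for a b :: nat
  proof -
    have "(a + b) * (a + b - 1) = a * (a - 1) + b * (b - 1) + 2 * (a * b)"
      by (cases a; cases b) (simp_all add: algebra_simps)
    moreover have "even (a * (a - 1))" "even (b * (b - 1))" by auto
    ultimately show ?thesis by (simp add: div_plus_div_distrib_dvd_left)
  qed
  show ?thesis unfolding sum by (auto simp: algebra_simps)
qed

lemma card_sym_diff_parts:
  assumes "finite A" "finite B"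
  shows "card (sym_diff A B) = card (A - B) + card (B - A)"
    and "card A = card (A - B) + card (A \<inter> B)"
    and "card B = card (B - A) + card (A \<inter> B)"
proof -
  show "card (sym_diff A B) = card (A - B) + card (B - A)"
    using assms by (intro card_Un_disjoint) auto
  show "card A = card (A - B) + card (A \<inter> B)"
    using card_Int_Diff[OF assms(1), of B] by simp
  show "card B = card (B - A) + card (A \<inter> B)"
    using card_Int_Diff[OF assms(2), of A] by (simp add: Int_commute)
qed

lemma reversion_closed: "U \<in> carrier (clifford \<eta>) \<Longrightarrow> reversion U \<in> carrier (clifford \<eta>)"
  by (simp add: reversion_def clifford_simps)

lemma grade_involution_closed:
  "U \<in> carrier (clifford \<eta>) \<Longrightarrow> grade_involution U \<in> carrier (clifford \<eta>)"
  by (simp add: grade_involution_def clifford_simps)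

text \<open>
  On blades both sides are multiples of the blade of the symmetric difference; that the multiples
  agree is \<open>reversion_sign_parity\<close>.
\<close>

lemma reversion_mult:
  assumes U: "U \<in> carrier (clifford \<eta>)" and V: "V \<in> carrier (clifford \<eta>)"
  shows "reversion (U \<otimes>\<^bsub>clifford \<eta>\<^esub> V) = reversion V \<otimes>\<^bsub>clifford \<eta>\<^esub> reversion U"
proof
  fix A
  define s :: "nat set \<Rightarrow> 'a" where "s = (\<lambda>A. (-1) ^ (card A * (card A - 1) div 2))"
  have rev: "reversion W = (\<lambda>A. s A * W A)" for W by (simp add: reversion_def s_def)
  have sign: "s (sym_diff B C) * blade_coeff \<eta> B C = blade_coeff \<eta> C B * s C * s B"
    if fin: "finite B" "finite C" for B C
  proof -
    note cards = card_sym_diff_parts[OF fin]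
    have "s (sym_diff B C) = s B * s C * (-1) ^ (card B * card C + card (B \<inter> C))"
      unfolding s_def cards power_add[symmetric]
      using reversion_sign_parity[of "card (B - C)" "card (C - B)" "card (B \<inter> C)"]
      by (simp only: minus_one_power_iff)
    then show ?thesis unfolding blade_coeff_swap[OF fin] by simp
  qed
  have closed: "U \<otimes>\<^bsub>clifford \<eta>\<^esub> V \<in> carrier (clifford \<eta>)"
    "reversion V \<otimes>\<^bsub>clifford \<eta>\<^esub> reversion U \<in> carrier (clifford \<eta>)"
    using U V by (auto intro!: clifford_mult_closed reversion_closed)
  show "reversion (U \<otimes>\<^bsub>clifford \<eta>\<^esub> V) A = (reversion V \<otimes>\<^bsub>clifford \<eta>\<^esub> reversion U) A"
  proof (cases "A \<subseteq> {..<length \<eta>}")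
    case False
    then show ?thesis using closed by (simp add: clifford_simps reversion_def)
  next
    case True
    have fin: "finite A" using True by (rule finite_subset) simp
    have "reversion (U \<otimes>\<^bsub>clifford \<eta>\<^esub> V) A = (\<Sum>B\<in>Pow {..<length \<eta>}.
        (s A * blade_coeff \<eta> B (sym_diff B A)) * U B * V (sym_diff B A))"
      by (simp add: rev clifford_mult sum_distrib_left mult_ac)
    also have "\<dots> = (\<Sum>B\<in>Pow {..<length \<eta>}. (blade_coeff \<eta> (sym_diff B A) B *
        s (sym_diff B A) * s B) * U B * V (sym_diff B A))"
    proof (rule sum.cong[OF refl])
      fix B assume "B \<in> Pow {..<length \<eta>}"
      then have "finite B" "finite (sym_diff B A)" using fin by (auto intro: finite_subset)
      moreover have "sym_diff B (sym_diff B A) = A" by blast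
      ultimately show "(s A * blade_coeff \<eta> B (sym_diff B A)) * U B * V (sym_diff B A) =
          (blade_coeff \<eta> (sym_diff B A) B * s (sym_diff B A) * s B) * U B * V (sym_diff B A)"
        using sign[of B "sym_diff B A"] by simp
    qed
    also have "\<dots> = (reversion V \<otimes>\<^bsub>clifford \<eta>\<^esub> reversion U) A"
      unfolding clifford_mult rev
    proof (rule sum.reindex_bij_witness[of _ "\<lambda>C. sym_diff C A" "\<lambda>C. sym_diff C A"])
      fix C
      have [simp]: "sym_diff (sym_diff C A) A = C" by blast
      show "sym_diff (sym_diff C A) A = C" "sym_diff (sym_diff C A) A = C" by simp_all
      show "blade_coeff \<eta> (sym_diff C A) (sym_diff (sym_diff C A) A) *
          (s (sym_diff C A) * V (sym_diff C A)) *
          (s (sym_diff (sym_diff C A) A) * U (sym_diff (sym_diff C A) A)) =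
        (blade_coeff \<eta> (sym_diff C A) C * s (sym_diff C A) * s C) * U C * V (sym_diff C A)"
        by (simp add: mult_ac)
    qed (use True in blast)+
    finally show ?thesis .
  qed
qed

lemma grade_involution_mult:
  assumes U: "U \<in> carrier (clifford \<eta>)" and V: "V \<in> carrier (clifford \<eta>)"
  shows "grade_involution (U \<otimes>\<^bsub>clifford \<eta>\<^esub> V) = grade_involution U \<otimes>\<^bsub>clifford \<eta>\<^esub> grade_involution V"
proof
  fix A
  have closed: "U \<otimes>\<^bsub>clifford \<eta>\<^esub> V \<in> carrier (clifford \<eta>)"
    "grade_involution U \<otimes>\<^bsub>clifford \<eta>\<^esub> grade_involution V \<in> carrier (clifford \<eta>)"
    using U V by (auto intro!: clifford_mult_closed grade_involution_closed)
  show "grade_involution (U \<otimes>\<^bsub>clifford \<eta>\<^esub> V) A =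
      (grade_involution U \<otimes>\<^bsub>clifford \<eta>\<^esub> grade_involution V) A"
  proof (cases "A \<subseteq> {..<length \<eta>}")
    case False
    then show ?thesis using closed by (simp add: clifford_simps grade_involution_def)
  next
    case True
    have "(-1) ^ card A = (-1) ^ card B * ((-1) ^ card (sym_diff B A) :: 'a)"
      if "B \<subseteq> {..<length \<eta>}" for B
    proof -
      have fin: "finite A" "finite B" using True that by (auto intro: finite_subset)
      note cards = card_sym_diff_parts[OF fin(2,1)]
      show ?thesis unfolding cards power_add[symmetric] by (auto simp: minus_one_power_iff)
    qed
    then show ?thesis
      by (auto simp: grade_involution_def clifford_mult sum_distrib_left mult_ac intro!: sum.cong)
  qed
qed

definition anti_endomorphism ::
    "'f::field list \<Rightarrow> ((nat set \<Rightarrow> 'f) \<Rightarrow> nat set \<Rightarrow> 'f) \<Rightarrow> bool" where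
  "anti_endomorphism \<eta> \<sigma> \<longleftrightarrow> \<sigma> \<in> carrier (clifford \<eta>) \<rightarrow> carrier (clifford \<eta>) \<and>
     \<sigma> \<one>\<^bsub>clifford \<eta>\<^esub> = \<one>\<^bsub>clifford \<eta>\<^esub> \<and>
     (\<forall>U\<in>carrier (clifford \<eta>). \<forall>V\<in>carrier (clifford \<eta>).
        \<sigma> (U \<otimes>\<^bsub>clifford \<eta>\<^esub> V) = \<sigma> V \<otimes>\<^bsub>clifford \<eta>\<^esub> \<sigma> U)"

lemma anti_endomorphism_reversion: "anti_endomorphism \<eta> reversion"
  by (auto simp: anti_endomorphism_def reversion_mult)
    (auto simp: reversion_def clifford_simps)

lemma anti_endomorphism_conjugation: "anti_endomorphism \<eta> (\<lambda>U. grade_involution (reversion U))"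
proof -
  have "reversion U \<in> carrier (clifford \<eta>)" if "U \<in> carrier (clifford \<eta>)" for U
    using that by (simp add: reversion_def clifford_simps)
  then show ?thesis
    by (auto simp: anti_endomorphism_def reversion_mult grade_involution_mult)
      (auto simp: reversion_def grade_involution_def clifford_simps)
qed

lemma anti_endomorphism_Units:
  assumes \<sigma>: "anti_endomorphism \<eta> \<sigma>" and T: "T \<in> Units (clifford \<eta>)"
  shows "\<sigma> T \<in> Units (clifford \<eta>)"
proof -
  interpret R: ring "clifford \<eta>" by (rule ring_clifford)
  let ?R = "clifford \<eta>"
  have T': "T \<in> carrier ?R" "inv\<^bsub>?R\<^esub> T \<in> carrier ?R" using T by auto
  have closed: "\<sigma> T \<in> carrier ?R" "\<sigma> (inv\<^bsub>?R\<^esub> T) \<in> carrier ?R"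
    using \<sigma> T' by (auto simp: anti_endomorphism_def)
  have "\<sigma> (inv\<^bsub>?R\<^esub> T) \<otimes>\<^bsub>?R\<^esub> \<sigma> T = \<sigma> (T \<otimes>\<^bsub>?R\<^esub> inv\<^bsub>?R\<^esub> T)"
    "\<sigma> T \<otimes>\<^bsub>?R\<^esub> \<sigma> (inv\<^bsub>?R\<^esub> T) = \<sigma> (inv\<^bsub>?R\<^esub> T \<otimes>\<^bsub>?R\<^esub> T)"
    using \<sigma> T' by (simp_all add: anti_endomorphism_def del: R.Units_r_inv R.Units_l_inv)
  then have "\<sigma> (inv\<^bsub>?R\<^esub> T) \<otimes>\<^bsub>?R\<^esub> \<sigma> T = \<one>\<^bsub>?R\<^esub>" "\<sigma> T \<otimes>\<^bsub>?R\<^esub> \<sigma> (inv\<^bsub>?R\<^esub> T) = \<one>\<^bsub>?R\<^esub>"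
    using \<sigma> T by (simp_all add: anti_endomorphism_def)
  with closed show ?thesis unfolding Units_def by blast
qed


section \<open>Stabilizers of eigenspaces\<close>

lemma clifford_smult_closed: "U \<in> carrier (clifford \<eta>) \<Longrightarrow> c \<odot>\<^bsub>clifford \<eta>\<^esub> U \<in> carrier (clifford \<eta>)"
  by (simp add: clifford_simps)

text \<open>
  Put \<open>W = T U T\<^sup>-\<^sup>1\<close>.  Applying \<open>\<sigma>\<close> to \<open>W T = T U\<close> gives \<open>\<sigma>(T) \<sigma>(W) = c U \<sigma>(T)\<close>, whereas
  \<open>\<sigma>(T) (c W) T = c \<sigma>(T) T U\<close>.  Comparing both after multiplication by \<open>T\<close> on the right settles
  it, since \<open>\<sigma>(T)\<close>, \<open>T\<close> and \<open>c\<close> can be cancelled.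
\<close>

lemma conjugate_in_eigenspace_iff:
  assumes \<sigma>: "anti_endomorphism \<eta> \<sigma>" and c: "c \<noteq> 0" and T: "T \<in> Units (clifford \<eta>)"
    and U: "U \<in> carrier (clifford \<eta>)" "\<sigma> U = c \<odot>\<^bsub>clifford \<eta>\<^esub> U"
  defines "W \<equiv> T \<otimes>\<^bsub>clifford \<eta>\<^esub> U \<otimes>\<^bsub>clifford \<eta>\<^esub> inv\<^bsub>clifford \<eta>\<^esub> T"
  shows "\<sigma> W = c \<odot>\<^bsub>clifford \<eta>\<^esub> W \<longleftrightarrow>
    \<sigma> T \<otimes>\<^bsub>clifford \<eta>\<^esub> T \<otimes>\<^bsub>clifford \<eta>\<^esub> U = U \<otimes>\<^bsub>clifford \<eta>\<^esub> (\<sigma> T \<otimes>\<^bsub>clifford \<eta>\<^esub> T)"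
proof -
  interpret R: ring "clifford \<eta>" by (rule ring_clifford)
  let ?R = "clifford \<eta>"
  have \<sigma>_closed: "\<sigma> X \<in> carrier ?R" if "X \<in> carrier ?R" for X
    using \<sigma> that by (auto simp: anti_endomorphism_def)
  have \<sigma>_mult: "\<sigma> (X \<otimes>\<^bsub>?R\<^esub> Y) = \<sigma> Y \<otimes>\<^bsub>?R\<^esub> \<sigma> X" if "X \<in> carrier ?R" "Y \<in> carrier ?R" for X Y
    using \<sigma> that by (auto simp: anti_endomorphism_def)
  have T': "T \<in> carrier ?R" using T by blast
  have W: "W \<in> carrier ?R" using T U by (auto simp: W_def)
  have WT: "W \<otimes>\<^bsub>?R\<^esub> T = T \<otimes>\<^bsub>?R\<^esub> U" using T T' U(1) by (simp add: W_def R.m_assoc)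
  have \<sigma>T: "\<sigma> T \<in> Units ?R" using anti_endomorphism_Units[OF \<sigma> T] .
  have cancel_right: "X \<otimes>\<^bsub>?R\<^esub> T = Y \<otimes>\<^bsub>?R\<^esub> T \<longleftrightarrow> X = Y"
    if "X \<in> carrier ?R" "Y \<in> carrier ?R" for X Y
  proof
    assume "X \<otimes>\<^bsub>?R\<^esub> T = Y \<otimes>\<^bsub>?R\<^esub> T"
    then have "X \<otimes>\<^bsub>?R\<^esub> T \<otimes>\<^bsub>?R\<^esub> inv\<^bsub>?R\<^esub> T = Y \<otimes>\<^bsub>?R\<^esub> T \<otimes>\<^bsub>?R\<^esub> inv\<^bsub>?R\<^esub> T" by simp
    then show "X = Y" using that T T' by (simp add: R.m_assoc)
  qed simp
  have "\<sigma> W = c \<odot>\<^bsub>?R\<^esub> W \<longleftrightarrow> \<sigma> T \<otimes>\<^bsub>?R\<^esub> \<sigma> W = \<sigma> T \<otimes>\<^bsub>?R\<^esub> (c \<odot>\<^bsub>?R\<^esub> W)"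
    using R.Units_l_cancel[OF \<sigma>T] \<sigma>_closed W by (simp add: clifford_smult_closed)
  also have "\<sigma> T \<otimes>\<^bsub>?R\<^esub> \<sigma> W = c \<odot>\<^bsub>?R\<^esub> (U \<otimes>\<^bsub>?R\<^esub> \<sigma> T)"
    using \<sigma>_mult[OF W T'] \<sigma>_mult[OF T' U(1)] by (simp add: WT U(2) clifford_smult_mult)
  also have "c \<odot>\<^bsub>?R\<^esub> (U \<otimes>\<^bsub>?R\<^esub> \<sigma> T) = \<sigma> T \<otimes>\<^bsub>?R\<^esub> (c \<odot>\<^bsub>?R\<^esub> W) \<longleftrightarrow>
      U \<otimes>\<^bsub>?R\<^esub> \<sigma> T = \<sigma> T \<otimes>\<^bsub>?R\<^esub> W"
    using c by (simp add: clifford_smult_mult) (auto simp: clifford_simps(5) fun_eq_iff)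
  also have "\<dots> \<longleftrightarrow> U \<otimes>\<^bsub>?R\<^esub> \<sigma> T \<otimes>\<^bsub>?R\<^esub> T = \<sigma> T \<otimes>\<^bsub>?R\<^esub> W \<otimes>\<^bsub>?R\<^esub> T"
    using \<sigma>_closed[OF T'] U(1) W by (simp add: cancel_right)
  also have "\<sigma> T \<otimes>\<^bsub>?R\<^esub> W \<otimes>\<^bsub>?R\<^esub> T = \<sigma> T \<otimes>\<^bsub>?R\<^esub> T \<otimes>\<^bsub>?R\<^esub> U"
    using \<sigma>_closed[OF T'] T' U(1) W by (simp add: R.m_assoc WT)
  also have "U \<otimes>\<^bsub>?R\<^esub> \<sigma> T \<otimes>\<^bsub>?R\<^esub> T = U \<otimes>\<^bsub>?R\<^esub> (\<sigma> T \<otimes>\<^bsub>?R\<^esub> T)"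
    using \<sigma>_closed[OF T'] T' U(1) by (simp add: R.m_assoc)
  finally show ?thesis by metis
qed

lemma Gam_eq_norm_in_centralizer:
  assumes \<sigma>: "anti_endomorphism \<eta> \<sigma>" and c: "c \<noteq> 0"
    and eigen: "Cl_bar2 \<eta> k l = {U \<in> carrier (clifford \<eta>). \<sigma> U = c \<odot>\<^bsub>clifford \<eta>\<^esub> U}"
  shows "Gam \<eta> k l =
    {T \<in> Units (clifford \<eta>). \<sigma> T \<otimes>\<^bsub>clifford \<eta>\<^esub> T \<in> centralizer \<eta> (Cl_bar2 \<eta> k l)}"
proof -
  interpret R: ring "clifford \<eta>" by (rule ring_clifford)
  have "T \<otimes>\<^bsub>clifford \<eta>\<^esub> U \<otimes>\<^bsub>clifford \<eta>\<^esub> inv\<^bsub>clifford \<eta>\<^esub> T \<in> Cl_bar2 \<eta> k l \<longleftrightarrow>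
      \<sigma> T \<otimes>\<^bsub>clifford \<eta>\<^esub> T \<otimes>\<^bsub>clifford \<eta>\<^esub> U = U \<otimes>\<^bsub>clifford \<eta>\<^esub> (\<sigma> T \<otimes>\<^bsub>clifford \<eta>\<^esub> T)"
    if "T \<in> Units (clifford \<eta>)" "U \<in> Cl_bar2 \<eta> k l" for T U
  proof -
    have "T \<otimes>\<^bsub>clifford \<eta>\<^esub> U \<otimes>\<^bsub>clifford \<eta>\<^esub> inv\<^bsub>clifford \<eta>\<^esub> T \<in> carrier (clifford \<eta>)"
      using that by (auto simp: eigen)
    then show ?thesis
      using conjugate_in_eigenspace_iff[OF \<sigma> c that(1), of U] that(2) by (simp add: eigen)
  qed
  moreover have "\<sigma> T \<otimes>\<^bsub>clifford \<eta>\<^esub> T \<in> carrier (clifford \<eta>)" if "T \<in> Units (clifford \<eta>)" for T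
    using that by (auto intro: clifford_mult_closed)
  ultimately show ?thesis by (auto simp: Gam_def centralizer_def)
qed


section \<open>Grades modulo 4 as eigenspaces\<close>

lemma even_choose_2_mod_4: "even (n * (n - 1) div 2) \<longleftrightarrow> n mod 4 \<in> {0, 1}" for n :: nat
proof -
  have n: "n = 4 * (n div 4) + n mod 4" by simp
  have "n mod 4 \<in> {0, 1, 2, 3}" by auto
  then obtain a b where ab: "n = 4 * a + b" "n mod 4 = b" "b \<in> {0, 1, 2, 3}" using n by metis
  have "(4 * a + b) * (4 * a + b - 1) = 2 * (2 * a * (4 * a + 2 * b - 1) + b * (b - 1) div 2)"
    using ab(3) by (cases a) (auto simp: algebra_simps)
  then have "n * (n - 1) div 2 = 2 * a * (4 * a + 2 * b - 1) + b * (b - 1) div 2"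
    unfolding ab(1) by simp
  then show ?thesis using ab(2,3) by auto
qed

lemma Cl_bar_eq_grades:
  fixes \<eta> :: "'f::field_char_0 list"
  assumes "k < 4"
  shows "Cl_bar \<eta> k = grades \<eta> {i. i mod 4 = k}"
proof -
  have signs: "(even i \<longleftrightarrow> even k) \<and> (even (i * (i - 1) div 2) \<longleftrightarrow> even (k * (k - 1) div 2)) \<longleftrightarrow>
      i mod 4 = k" for i
  proof -
    have "even i \<longleftrightarrow> even (i mod 4)" by (simp add: dvd_mod_iff)
    moreover have "i mod 4 \<in> {0, 1, 2, 3}" "k \<in> {0, 1, 2, 3}" using assms by auto
    ultimately show ?thesis unfolding even_choose_2_mod_4 using assms by auto
  qed
  have eigen: "(-1) ^ a * x = (-1) ^ b * x \<longleftrightarrow> x = 0 \<or> (even a \<longleftrightarrow> even b)"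
    for a b :: nat and x :: 'f
    by (auto simp: minus_one_power_iff)
  show ?thesis
    unfolding Cl_bar_def grades_def grade_involution_def reversion_def clifford_simps(5)
      fun_eq_iff eigen
    using signs by blast
qed

lemma Cl_bar2_eq_grades:
  fixes \<eta> :: "'f::field_char_0 list"
  assumes "k < 4" "l < 4"
  shows "Cl_bar2 \<eta> k l = grades \<eta> {i. i mod 4 = k \<or> i mod 4 = l}"
proof
  show "Cl_bar2 \<eta> k l \<subseteq> grades \<eta> {i. i mod 4 = k \<or> i mod 4 = l}"
  proof
    fix W assume "W \<in> Cl_bar2 \<eta> k l"
    then obtain U V where U: "U \<in> grades \<eta> {i. i mod 4 = k}" and V: "V \<in> grades \<eta> {i. i mod 4 = l}"
      and W: "W = (\<lambda>A. U A + V A)"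
      unfolding Cl_bar2_def set_add_def' Cl_bar_eq_grades[OF assms(1)] Cl_bar_eq_grades[OF assms(2)]
        clifford_simps by blast
    have "U A \<noteq> 0 \<or> V A \<noteq> 0" if "W A \<noteq> 0" for A using that by (auto simp: W)
    then show "W \<in> grades \<eta> {i. i mod 4 = k \<or> i mod 4 = l}"
      using U V unfolding grades_def clifford_simps(1) by blast
  qed
  show "grades \<eta> {i. i mod 4 = k \<or> i mod 4 = l} \<subseteq> Cl_bar2 \<eta> k l"
  proof
    fix U assume U: "U \<in> grades \<eta> {i. i mod 4 = k \<or> i mod 4 = l}"
    let ?P = "\<lambda>A. if card A mod 4 = k then U A else 0"
    let ?Q = "\<lambda>A. if card A mod 4 = k then 0 else U A"
    have "?P \<in> Cl_bar \<eta> k" "?Q \<in> Cl_bar \<eta> l"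
      using U by (auto simp: Cl_bar_eq_grades assms grades_def clifford_simps)
    moreover have "U = ?P \<oplus>\<^bsub>clifford \<eta>\<^esub> ?Q" by (auto simp: clifford_simps)
    ultimately show "U \<in> Cl_bar2 \<eta> k l" unfolding Cl_bar2_def set_add_def' by blast
  qed
qed

lemma Cl_bar2_eq_reversion_eigenspace:
  fixes \<eta> :: "'f::field_char_0 list"
  shows "Cl_bar2 \<eta> 0 1 = {U \<in> carrier (clifford \<eta>). reversion U = 1 \<odot>\<^bsub>clifford \<eta>\<^esub> U}"
    and "Cl_bar2 \<eta> 2 3 = {U \<in> carrier (clifford \<eta>). reversion U = (-1) \<odot>\<^bsub>clifford \<eta>\<^esub> U}"
proof -
  have *: "i mod 4 = 2 \<or> i mod 4 = 3 \<longleftrightarrow> \<not> (i mod 4 = 0 \<or> i mod 4 = 1)" for i :: nat by auto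
  show "Cl_bar2 \<eta> 0 1 = {U \<in> carrier (clifford \<eta>). reversion U = 1 \<odot>\<^bsub>clifford \<eta>\<^esub> U}"
    "Cl_bar2 \<eta> 2 3 = {U \<in> carrier (clifford \<eta>). reversion U = (-1) \<odot>\<^bsub>clifford \<eta>\<^esub> U}"
    using even_choose_2_mod_4
    by (simp_all add: Cl_bar2_eq_grades grades_def reversion_def clifford_simps(5) fun_eq_iff
        minus_one_power_iff *) (auto split: if_splits)
qed

lemma Cl_bar2_eq_conjugation_eigenspace:
  fixes \<eta> :: "'f::field_char_0 list"
  shows "Cl_bar2 \<eta> 0 3 =
      {U \<in> carrier (clifford \<eta>). grade_involution (reversion U) = 1 \<odot>\<^bsub>clifford \<eta>\<^esub> U}"
    and "Cl_bar2 \<eta> 1 2 =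
      {U \<in> carrier (clifford \<eta>). grade_involution (reversion U) = (-1) \<odot>\<^bsub>clifford \<eta>\<^esub> U}"
proof -
  have sign: "(-1) ^ i * ((-1) ^ (i * (i - 1) div 2) * x) =
      (if i mod 4 = 0 \<or> i mod 4 = 3 then x else - x)" for i :: nat and x :: 'f
  proof -
    have "even i \<longleftrightarrow> even (i mod 4)" by (simp add: dvd_mod_iff)
    moreover have "i mod 4 \<in> {0, 1, 2, 3}" by auto
    ultimately show ?thesis
      using even_choose_2_mod_4[of i] by (auto simp: minus_one_power_iff)
  qed
  have *: "i mod 4 = 1 \<or> i mod 4 = 2 \<longleftrightarrow> \<not> (i mod 4 = 0 \<or> i mod 4 = 3)" for i :: nat by auto
  have Cl_bar2_03: "Cl_bar2 \<eta> 0 3 = grades \<eta> {i. i mod 4 = 0 \<or> i mod 4 = 3}"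
    and Cl_bar2_12: "Cl_bar2 \<eta> 1 2 = grades \<eta> {i. i mod 4 = 1 \<or> i mod 4 = 2}"
    by (rule Cl_bar2_eq_grades; simp)+
  have eigen: "(if P then x else - x) = 1 * x \<longleftrightarrow> (x \<noteq> 0 \<longrightarrow> P)"
    "(if P then x else - x) = - 1 * x \<longleftrightarrow> (x \<noteq> 0 \<longrightarrow> \<not> P)" for P and x :: 'f
    by auto
  show "Cl_bar2 \<eta> 0 3 =
      {U \<in> carrier (clifford \<eta>). grade_involution (reversion U) = 1 \<odot>\<^bsub>clifford \<eta>\<^esub> U}"
    "Cl_bar2 \<eta> 1 2 =
      {U \<in> carrier (clifford \<eta>). grade_involution (reversion U) = (-1) \<odot>\<^bsub>clifford \<eta>\<^esub> U}"
    unfolding Cl_bar2_03 Cl_bar2_12 grades_def grade_involution_def reversion_def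
      clifford_simps(5) fun_eq_iff sign eigen * by simp_all
qed


section \<open>Centralizers and the groups\<close>

text \<open>
  In each case one inclusion holds because the subspace contains the grades \<open>m\<close> that occur in the
  \<open>Z m\<close> on the right; the other one is \<open>centralizer_odd_grade\<close>, applied in the last case to
  the grades from 3 on.
\<close>

lemma centralizer_Cl_bar2:
  fixes \<eta> :: "'f::field_char_0 list"
  shows "centralizer \<eta> (Cl_bar2 \<eta> 0 1) = Z \<eta> 1"
    and "centralizer \<eta> (Cl_bar2 \<eta> 1 2) = Z \<eta> 1"
    and "centralizer \<eta> (Cl_bar2 \<eta> 0 3) = Z \<eta> 3"
    and "centralizer \<eta> (Cl_bar2 \<eta> 2 3) = Z \<eta> 2 \<inter> Z \<eta> 3"
proof -
  have sub_Z: "centralizer \<eta> (grades \<eta> K) \<subseteq> Z \<eta> m" if "m \<in> K" for K m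
    unfolding Z_eq_centralizer using that by (intro centralizer_mono grades_mono) auto
  show "centralizer \<eta> (Cl_bar2 \<eta> 0 1) = Z \<eta> 1"
    by (simp add: Cl_bar2_eq_grades, intro equalityI sub_Z centralizer_odd_grade) auto
  show "centralizer \<eta> (Cl_bar2 \<eta> 1 2) = Z \<eta> 1"
    by (simp add: Cl_bar2_eq_grades, intro equalityI sub_Z centralizer_odd_grade) auto
  show "centralizer \<eta> (Cl_bar2 \<eta> 0 3) = Z \<eta> 3"
  proof -
    have "i = 0 \<or> 3 \<le> i" if "i mod 4 = 0 \<or> i mod 4 = 3" for i :: nat using that by presburger
    then show ?thesis
      by (simp add: Cl_bar2_eq_grades, intro equalityI sub_Z centralizer_odd_grade) auto
  qed
  let ?K = "{i::nat. i mod 4 = 2 \<or> i mod 4 = 3}"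
  have "Z \<eta> 2 \<inter> Z \<eta> 3 \<subseteq> centralizer \<eta> (grades \<eta> ?K)"
  proof
    fix X assume X: "X \<in> Z \<eta> 2 \<inter> Z \<eta> 3"
    then have carrier: "X \<in> carrier (clifford \<eta>)" by (simp add: Z_def)
    have "X \<in> centralizer \<eta> (grades \<eta> (?K - {2}))"
    proof (rule subsetD[OF centralizer_odd_grade[of 3]])
      show "i = 0 \<or> 3 \<le> i" if "i \<in> ?K - {2}" for i using that by simp presburger
    qed (use X in auto)
    moreover have "X \<in> centralizer \<eta> (grades \<eta> {2})" using X by (simp add: Z_eq_centralizer)
    ultimately show "X \<in> centralizer \<eta> (grades \<eta> ?K)"
      unfolding commutes_with_grades_iff[OF carrier] by blast
  qed
  then show "centralizer \<eta> (Cl_bar2 \<eta> 2 3) = Z \<eta> 2 \<inter> Z \<eta> 3"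
    using sub_Z[of 2 ?K] sub_Z[of 3 ?K] by (auto simp: Cl_bar2_eq_grades)
qed

lemma Z1_subset_Z:
  fixes \<eta> :: "'f::field_char_0 list"
  shows "Z \<eta> 1 \<subseteq> Z \<eta> m"
  unfolding Z_eq_centralizer[of \<eta> m] by (rule centralizer_odd_grade) auto

text \<open>
  An invertible norm \<open>\<sigma>(T) T\<close> provides a left inverse of \<open>T\<close>, so \<open>T\<close> itself is a unit; conversely
  \<open>\<sigma>\<close> maps units to units.
\<close>

lemma norm_in_invertibles_iff:
  assumes \<sigma>: "anti_endomorphism \<eta> \<sigma>" and T: "T \<in> carrier (clifford \<eta>)"
  shows "\<sigma> T \<otimes>\<^bsub>clifford \<eta>\<^esub> T \<in> invertibles \<eta> H \<longleftrightarrow>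
    T \<in> Units (clifford \<eta>) \<and> \<sigma> T \<otimes>\<^bsub>clifford \<eta>\<^esub> T \<in> H"
proof -
  interpret R: ring "clifford \<eta>" by (rule ring_clifford)
  have \<sigma>T: "\<sigma> T \<in> carrier (clifford \<eta>)" using \<sigma> T by (auto simp: anti_endomorphism_def)
  show ?thesis
    using anti_endomorphism_Units[OF \<sigma>] left_factor_of_unit_imp_unit[OF \<sigma>T T]
    by (auto simp: invertibles_def)
qed

lemma norm_groups_eq_stabilizers:
  fixes \<eta> :: "'f::field_char_0 list"
  shows "A01 \<eta> = psi_preimage \<eta> (invertibles \<eta> (Z \<eta> 1))"
    and "psi_preimage \<eta> (invertibles \<eta> (Z \<eta> 1)) = Gam \<eta> 0 1"
    and "Gam \<eta> 0 1 \<subseteq> A23 \<eta>"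
    and "A23 \<eta> = psi_preimage \<eta> (invertibles \<eta> (Z \<eta> 2 \<inter> Z \<eta> 3))"
    and "psi_preimage \<eta> (invertibles \<eta> (Z \<eta> 2 \<inter> Z \<eta> 3)) = Gam \<eta> 2 3"
    and "B12 \<eta> = chi_preimage \<eta> (invertibles \<eta> (Z \<eta> 1))"
    and "chi_preimage \<eta> (invertibles \<eta> (Z \<eta> 1)) = Gam \<eta> 1 2"
    and "Gam \<eta> 1 2 \<subseteq> B03 \<eta>"
    and "B03 \<eta> = chi_preimage \<eta> (invertibles \<eta> (Z \<eta> 3))"
    and "chi_preimage \<eta> (invertibles \<eta> (Z \<eta> 3)) = Gam \<eta> 0 3"
proof -
  interpret R: ring "clifford \<eta>" by (rule ring_clifford)
  have units: "T \<in> carrier (clifford \<eta>)" if "T \<in> Units (clifford \<eta>)" for T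
    using that by blast
  note norms = norm_in_invertibles_iff[OF anti_endomorphism_reversion]
    norm_in_invertibles_iff[OF anti_endomorphism_conjugation]
  note Gam_reversion = Gam_eq_norm_in_centralizer[OF anti_endomorphism_reversion]
  note Gam_conjugation = Gam_eq_norm_in_centralizer[OF anti_endomorphism_conjugation]
  have Gam:
    "Gam \<eta> 0 1 = {T \<in> Units (clifford \<eta>). reversion T \<otimes>\<^bsub>clifford \<eta>\<^esub> T \<in> Z \<eta> 1}"
    "Gam \<eta> 2 3 = {T \<in> Units (clifford \<eta>). reversion T \<otimes>\<^bsub>clifford \<eta>\<^esub> T \<in> Z \<eta> 2 \<inter> Z \<eta> 3}"
    "Gam \<eta> 1 2 = {T \<in> Units (clifford \<eta>).
       grade_involution (reversion T) \<otimes>\<^bsub>clifford \<eta>\<^esub> T \<in> Z \<eta> 1}"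
    "Gam \<eta> 0 3 = {T \<in> Units (clifford \<eta>).
       grade_involution (reversion T) \<otimes>\<^bsub>clifford \<eta>\<^esub> T \<in> Z \<eta> 3}"
    using Gam_reversion[OF _ Cl_bar2_eq_reversion_eigenspace(1)]
      Gam_reversion[OF _ Cl_bar2_eq_reversion_eigenspace(2)]
      Gam_conjugation[OF _ Cl_bar2_eq_conjugation_eigenspace(1)]
      Gam_conjugation[OF _ Cl_bar2_eq_conjugation_eigenspace(2)]
    unfolding centralizer_Cl_bar2 by simp_all
  have groups:
    "A01 \<eta> = {T \<in> Units (clifford \<eta>). reversion T \<otimes>\<^bsub>clifford \<eta>\<^esub> T \<in> Z \<eta> 1}"
    "A23 \<eta> = {T \<in> Units (clifford \<eta>). reversion T \<otimes>\<^bsub>clifford \<eta>\<^esub> T \<in> Z \<eta> 2 \<inter> Z \<eta> 3}"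
    "B12 \<eta> = {T \<in> Units (clifford \<eta>).
       grade_involution (reversion T) \<otimes>\<^bsub>clifford \<eta>\<^esub> T \<in> Z \<eta> 1}"
    "B03 \<eta> = {T \<in> Units (clifford \<eta>).
       grade_involution (reversion T) \<otimes>\<^bsub>clifford \<eta>\<^esub> T \<in> Z \<eta> 3}"
    by (auto simp: A01_def A23_def B12_def B03_def norms units simp del: One_nat_def)
  have preimages:
    "psi_preimage \<eta> (invertibles \<eta> H) =
       {T \<in> Units (clifford \<eta>). reversion T \<otimes>\<^bsub>clifford \<eta>\<^esub> T \<in> H}"
    "chi_preimage \<eta> (invertibles \<eta> H) =
       {T \<in> Units (clifford \<eta>). grade_involution (reversion T) \<otimes>\<^bsub>clifford \<eta>\<^esub> T \<in> H}" for H
    by (auto simp: psi_preimage_def chi_preimage_def psi_def chi_def norms units)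
  show "A01 \<eta> = psi_preimage \<eta> (invertibles \<eta> (Z \<eta> 1))"
    "psi_preimage \<eta> (invertibles \<eta> (Z \<eta> 1)) = Gam \<eta> 0 1"
    "Gam \<eta> 0 1 \<subseteq> A23 \<eta>"
    "A23 \<eta> = psi_preimage \<eta> (invertibles \<eta> (Z \<eta> 2 \<inter> Z \<eta> 3))"
    "psi_preimage \<eta> (invertibles \<eta> (Z \<eta> 2 \<inter> Z \<eta> 3)) = Gam \<eta> 2 3"
    "B12 \<eta> = chi_preimage \<eta> (invertibles \<eta> (Z \<eta> 1))"
    "chi_preimage \<eta> (invertibles \<eta> (Z \<eta> 1)) = Gam \<eta> 1 2"
    "Gam \<eta> 1 2 \<subseteq> B03 \<eta>"
    "B03 \<eta> = chi_preimage \<eta> (invertibles \<eta> (Z \<eta> 3))"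
    "chi_preimage \<eta> (invertibles \<eta> (Z \<eta> 3)) = Gam \<eta> 0 3"
    unfolding Gam groups preimages using Z1_subset_Z by blast+
qed

theorem theorem4p1:
  fixes p q r :: nat and \<eta> :: "real list" and \<zeta> :: "complex list"
  assumes n: "p + q + r \<ge> 1"
    and real_case: "\<eta> = real_metric p q r"
    and complex_case: "\<zeta> = complex_metric p q r"
  shows
   "(A01 \<eta> = psi_preimage \<eta> (invertibles \<eta> (Z \<eta> 1)) \<and>
     psi_preimage \<eta> (invertibles \<eta> (Z \<eta> 1)) = Gam \<eta> 0 1 \<and>
     Gam \<eta> 0 1 \<subseteq> A23 \<eta> \<and>
     A23 \<eta> = psi_preimage \<eta> (invertibles \<eta> (Z \<eta> 2 \<inter> Z \<eta> 3)) \<and>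
     psi_preimage \<eta> (invertibles \<eta> (Z \<eta> 2 \<inter> Z \<eta> 3)) = Gam \<eta> 2 3 \<and>
     B12 \<eta> = chi_preimage \<eta> (invertibles \<eta> (Z \<eta> 1)) \<and>
     chi_preimage \<eta> (invertibles \<eta> (Z \<eta> 1)) = Gam \<eta> 1 2 \<and>
     Gam \<eta> 1 2 \<subseteq> B03 \<eta> \<and>
     B03 \<eta> = chi_preimage \<eta> (invertibles \<eta> (Z \<eta> 3)) \<and>
     chi_preimage \<eta> (invertibles \<eta> (Z \<eta> 3)) = Gam \<eta> 0 3) \<and>
    (A01 \<zeta> = psi_preimage \<zeta> (invertibles \<zeta> (Z \<zeta> 1)) \<and>
     psi_preimage \<zeta> (invertibles \<zeta> (Z \<zeta> 1)) = Gam \<zeta> 0 1 \<and>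
     Gam \<zeta> 0 1 \<subseteq> A23 \<zeta> \<and>
     A23 \<zeta> = psi_preimage \<zeta> (invertibles \<zeta> (Z \<zeta> 2 \<inter> Z \<zeta> 3)) \<and>
     psi_preimage \<zeta> (invertibles \<zeta> (Z \<zeta> 2 \<inter> Z \<zeta> 3)) = Gam \<zeta> 2 3 \<and>
     B12 \<zeta> = chi_preimage \<zeta> (invertibles \<zeta> (Z \<zeta> 1)) \<and>
     chi_preimage \<zeta> (invertibles \<zeta> (Z \<zeta> 1)) = Gam \<zeta> 1 2 \<and>
     Gam \<zeta> 1 2 \<subseteq> B03 \<zeta> \<and>
     B03 \<zeta> = chi_preimage \<zeta> (invertibles \<zeta> (Z \<zeta> 3)) \<and>
     chi_preimage \<zeta> (invertibles \<zeta> (Z \<zeta> 3)) = Gam \<zeta> 0 3)"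
  unfolding real_case complex_case by (intro conjI norm_groups_eq_stabilizers)

end
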